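(* Let $\theta$ be a permutation of $\{1,\dots,m\}\times\{1,\dots,n\}$. (A) Suppose $2\le m\le n$, and let $a,b$ be positive integers. Then the following are equivalent: (1) every tail of $\mathbb{F}_\theta^+$ is eventually $(a,-b)$-periodic; (2) every tail of $\mathbb{F}_\theta^+$ is $(a,-b)$-periodic; (3) $m^a=n^b$ and there is a bijection $\gamma:\mathbf m^a\to\mathbf n^b$ such that $$e_uf_v=f_{\gamma(u)}e_{\gamma^{-1}(v)}\quad\text{for all } u\in\mathbf m^a,\ v\in\mathbf n^b.$$ (B) If $1=m<n$, and $\theta$ is regarded as a permutation of $\{1,\dots,n\}$ (so that $e_1f_j=f_{\theta(j)}e_1$), then $\mathbb{F}_\theta^+$ is $(0,b)$-periodic, where $b$ is the order of the permutation $\theta$.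
   Context: Semigroup. For a permutation $\theta$ of $\{1,\dots,m\}\times\{1,\dots,n\}$, $\mathbb{F}_\theta^+$ is the unital semigroup generated by $e_1,\dots,e_m,f_1,\dots,f_n$ subject only to the relations $e_if_j=f_{j'}e_{i'}$ whenever $\theta(i,j)=(i',j')$. A word $w$ with $k$ $e$'s and $l$ $f$'s has degree $d(w)=(k,l)$ (well defined). Every element of degree $(k,l)$ can be uniquely factored with any prescribed pattern of $k$ $e$'s and $l$ $f$'s. Write $\mathbf m=\{1,\dots,m\}$, $\mathbf n=\{1,\dots,n\}$; $\mathbf m^a$ and $\mathbf n^b$ are the sets of $a$-tuples and $b$-tuples (words); for $u=i_1\cdots i_a\in\mathbf m^a$ put $e_u=e_{i_1}\cdots e_{i_a}$, and similarly $f_v$ for $v\in\mathbf n^b$. Tails. A tail is an infinite word $\tau=e_{i_0}f_{j_0}e_{i_1}f_{j_1}\cdots$. Let $\tau_T=e_{i_0}f_{j_0}\cdots e_{i_{T-1}}f_{j_{T-1}}$. For integers $s,t\le 0$, choose $T>\max(|s|,|t|)$, factor $\tau_T=w_1w_2$ with $d(w_1)=(|s|,|t|)$, and write $w_2=e_iw'=f_jw''$; then $i_{s,t}:=i$ and $j_{s,t}:=j$ (independent of $T$). The integer data of $\tau$ is $\Sigma(\tau)=\{(i_{s,t},j_{s,t}):s,t\le0\}$. Periodicity. For $(p,q)\in\mathbb Z^2$, $\tau$ is eventually $(p,q)$-periodic if there is an integer $T$ such that $(i_{s+p,t+q},j_{s+p,t+q})=(i_{s,t},j_{s,t})$ for all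 $s,t\le T$ (with $T$ small enough that both sides are defined). It is $(p,q)$-periodic if this equality holds whenever $s,t,s+p,t+q\le0$. The semigroup $\mathbb{F}_\theta^+$ is said to be $(p,q)$-periodic if every tail of $\mathbb{F}_\theta^+$ is $(p,q)$-periodic.
   Formalization: In (B) the period is stated as (b,0) instead of (0,b): with degrees counting e's first, (0,b) is false, e.g. n=2, θ=id (b=1), tail e f_1 e f_2 e f_2 ... has j_{0,0}=1 but j_{0,-1}=2; the relation e_1 f_j = f_{θ(j)} e_1 gives (b,0). *)

theory Defs
  imports "HOL-Algebra.Sym_Groups" "HOL-Algebra.Multiplicative_Group"
begin

section \<open>The semigroup\<close>

datatype letter = Egen nat | Fgen nat

definition gen_words :: "nat \<Rightarrow> nat \<Rightarrow> letter list set" where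
  "gen_words m n = lists (Egen ` {1..m} \<union> Fgen ` {1..n})"

text \<open>The least congruence on the free monoid of words that contains the commutation relations.\<close>

inductive word_cong :: "nat \<Rightarrow> nat \<Rightarrow> (nat \<times> nat \<Rightarrow> nat \<times> nat) \<Rightarrow> letter list \<Rightarrow> letter list \<Rightarrow> bool"
  for m n :: nat and \<theta> :: "nat \<times> nat \<Rightarrow> nat \<times> nat"
where
  word_cong_comm: "i \<in> {1..m} \<Longrightarrow> j \<in> {1..n} \<Longrightarrow> \<theta> (i, j) = (i', j') \<Longrightarrow>
           word_cong m n \<theta> [Egen i, Fgen j] [Fgen j', Egen i']"
| word_cong_refl: "x \<in> gen_words m n \<Longrightarrow> word_cong m n \<theta> x x"
| word_cong_sym: "word_cong m n \<theta> x y \<Longrightarrow> word_cong m n \<theta> y x"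
| word_cong_trans: "word_cong m n \<theta> x y \<Longrightarrow> word_cong m n \<theta> y z \<Longrightarrow> word_cong m n \<theta> x z"
| word_cong_app: "word_cong m n \<theta> x y \<Longrightarrow> word_cong m n \<theta> x' y' \<Longrightarrow> word_cong m n \<theta> (x @ x') (y @ y')"

definition word_rel :: "nat \<Rightarrow> nat \<Rightarrow> (nat \<times> nat \<Rightarrow> nat \<times> nat) \<Rightarrow> (letter list \<times> letter list) set" where
  "word_rel m n \<theta> = {(x, y). word_cong m n \<theta> x y}"

definition Fplus :: "nat \<Rightarrow> nat \<Rightarrow> (nat \<times> nat \<Rightarrow> nat \<times> nat) \<Rightarrow> letter list set monoid" where
  "Fplus m n \<theta> =
     \<lparr> carrier = gen_words m n // word_rel m n \<theta>,
       mult = (\<lambda>A B. \<Union>x\<in>A. \<Union>y\<in>B. word_rel m n \<theta> `` {x @ y}),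
       one = word_rel m n \<theta> `` {[]} \<rparr>"

definition e_gen :: "nat \<Rightarrow> nat \<Rightarrow> (nat \<times> nat \<Rightarrow> nat \<times> nat) \<Rightarrow> nat \<Rightarrow> letter list set" where
  "e_gen m n \<theta> i = word_rel m n \<theta> `` {[Egen i]}"

definition f_gen :: "nat \<Rightarrow> nat \<Rightarrow> (nat \<times> nat \<Rightarrow> nat \<times> nat) \<Rightarrow> nat \<Rightarrow> letter list set" where
  "f_gen m n \<theta> j = word_rel m n \<theta> `` {[Fgen j]}"

definition tuples :: "nat \<Rightarrow> nat \<Rightarrow> nat list set" where
  "tuples m a = {u. set u \<subseteq> {1..m} \<and> length u = a}"

definition e_word :: "nat \<Rightarrow> nat \<Rightarrow> (nat \<times> nat \<Rightarrow> nat \<times> nat) \<Rightarrow> nat list \<Rightarrow> letter list set" where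
  "e_word m n \<theta> u = foldr (\<lambda>i w. e_gen m n \<theta> i \<otimes>\<^bsub>Fplus m n \<theta>\<^esub> w) u \<one>\<^bsub>Fplus m n \<theta>\<^esub>"

definition f_word :: "nat \<Rightarrow> nat \<Rightarrow> (nat \<times> nat \<Rightarrow> nat \<times> nat) \<Rightarrow> nat list \<Rightarrow> letter list set" where
  "f_word m n \<theta> v = foldr (\<lambda>j w. f_gen m n \<theta> j \<otimes>\<^bsub>Fplus m n \<theta>\<^esub> w) v \<one>\<^bsub>Fplus m n \<theta>\<^esub>"

definition word_degree :: "letter list \<Rightarrow> nat \<times> nat" where
  "word_degree x = (length (filter (\<lambda>c. \<exists>i. c = Egen i) x), length (filter (\<lambda>c. \<exists>j. c = Fgen j) x))"

text \<open>All representatives of a class have the same degree; see \<open>degree_class\<close> below.\<close>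

definition degree :: "letter list set \<Rightarrow> nat \<times> nat" where
  "degree w = the_elem (word_degree ` w)"

section \<open>Tails and periodicity\<close>

text \<open>A tail \<open>e\<^sub>i\<^sub>0 f\<^sub>j\<^sub>0 e\<^sub>i\<^sub>1 f\<^sub>j\<^sub>1 \<dots>\<close> is encoded by the sequence of pairs \<open>\<tau> k = (i\<^sub>k, j\<^sub>k)\<close>.\<close>

definition is_tail :: "nat \<Rightarrow> nat \<Rightarrow> (nat \<Rightarrow> nat \<times> nat) \<Rightarrow> bool" where
  "is_tail m n \<tau> \<longleftrightarrow> (\<forall>k. \<tau> k \<in> {1..m} \<times> {1..n})"

primrec tail_prefix ::
  "nat \<Rightarrow> nat \<Rightarrow> (nat \<times> nat \<Rightarrow> nat \<times> nat) \<Rightarrow> (nat \<Rightarrow> nat \<times> nat) \<Rightarrow> nat \<Rightarrow> letter list set"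
where
  "tail_prefix m n \<theta> \<tau> 0 = \<one>\<^bsub>Fplus m n \<theta>\<^esub>"
| "tail_prefix m n \<theta> \<tau> (Suc T) =
     tail_prefix m n \<theta> \<tau> T \<otimes>\<^bsub>Fplus m n \<theta>\<^esub>
       (e_gen m n \<theta> (fst (\<tau> T)) \<otimes>\<^bsub>Fplus m n \<theta>\<^esub> f_gen m n \<theta> (snd (\<tau> T)))"

text \<open>
  \<open>int_data m n \<theta> \<tau> s t\<close> is the pair \<open>(i\<^sub>s\<^sub>t, j\<^sub>s\<^sub>t)\<close>, meaningful only for \<open>s, t \<le> 0\<close>.
  The pair exists, is unique, and does not depend on the choice of \<open>T\<close>, because factorizations
  with a prescribed pattern of generators are unique.
\<close>

definition int_data ::
  "nat \<Rightarrow> nat \<Rightarrow> (nat \<times> nat \<Rightarrow> nat \<times> nat) \<Rightarrow> (nat \<Rightarrow> nat \<times> nat) \<Rightarrow> int \<Rightarrow> int \<Rightarrow> nat \<times> nat"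
where
  "int_data m n \<theta> \<tau> s t = (THE (i, j).
     i \<in> {1..m} \<and> j \<in> {1..n} \<and>
     (\<exists>T > max (nat \<bar>s\<bar>) (nat \<bar>t\<bar>).
        \<exists>w\<^sub>1 \<in> carrier (Fplus m n \<theta>). \<exists>w\<^sub>2 \<in> carrier (Fplus m n \<theta>).
          tail_prefix m n \<theta> \<tau> T = w\<^sub>1 \<otimes>\<^bsub>Fplus m n \<theta>\<^esub> w\<^sub>2 \<and>
          degree w\<^sub>1 = (nat \<bar>s\<bar>, nat \<bar>t\<bar>) \<and>
          (\<exists>w' \<in> carrier (Fplus m n \<theta>). w\<^sub>2 = e_gen m n \<theta> i \<otimes>\<^bsub>Fplus m n \<theta>\<^esub> w') \<and>
          (\<exists>w'' \<in> carrier (Fplus m n \<theta>). w\<^sub>2 = f_gen m n \<theta> j \<otimes>\<^bsub>Fplus m n \<theta>\<^esub> w'')))"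

text \<open>The bounds on \<open>T\<close> ensure that the data are defined on both sides for all \<open>s, t \<le> T\<close>.\<close>

definition eventually_periodic_tail ::
  "nat \<Rightarrow> nat \<Rightarrow> (nat \<times> nat \<Rightarrow> nat \<times> nat) \<Rightarrow> int \<times> int \<Rightarrow> (nat \<Rightarrow> nat \<times> nat) \<Rightarrow> bool"
where
  "eventually_periodic_tail m n \<theta> = (\<lambda>(p, q) \<tau>.
     \<exists>T::int. T \<le> 0 \<and> T + p \<le> 0 \<and> T + q \<le> 0 \<and>
       (\<forall>s\<le>T. \<forall>t\<le>T. int_data m n \<theta> \<tau> (s + p) (t + q) = int_data m n \<theta> \<tau> s t))"

definition periodic_tail ::
  "nat \<Rightarrow> nat \<Rightarrow> (nat \<times> nat \<Rightarrow> nat \<times> nat) \<Rightarrow> int \<times> int \<Rightarrow> (nat \<Rightarrow> nat \<times> nat) \<Rightarrow> bool"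
where
  "periodic_tail m n \<theta> = (\<lambda>(p, q) \<tau>.
     \<forall>s t. s \<le> 0 \<and> t \<le> 0 \<and> s + p \<le> 0 \<and> t + q \<le> 0 \<longrightarrow>
       int_data m n \<theta> \<tau> (s + p) (t + q) = int_data m n \<theta> \<tau> s t)"

definition periodic_semigroup ::
  "nat \<Rightarrow> nat \<Rightarrow> (nat \<times> nat \<Rightarrow> nat \<times> nat) \<Rightarrow> int \<times> int \<Rightarrow> bool"
where
  "periodic_semigroup m n \<theta> pq \<longleftrightarrow> (\<forall>\<tau>. is_tail m n \<tau> \<longrightarrow> periodic_tail m n \<theta> pq \<tau>)"

text \<open>
  For \<open>m = 1\<close>: the permutation \<open>\<theta>\<close> of \<open>{1} \<times> {1..n}\<close> viewed as a permutation of \<open>{1..n}\<close>, so that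
  \<open>e\<^sub>1 f\<^sub>j = f\<^sub>k e\<^sub>1\<close> with \<open>k = row_perm \<theta> j\<close>. It relates the data at \<open>(s - 1, t)\<close> to those at
  \<open>(s, t)\<close>: the first coordinate of a degree counts the letter \<open>e\<close>, so with these conventions the
  resulting period of order \<open>b\<close> is \<open>(b, 0)\<close> and not \<open>(0, b)\<close>.
\<close>

definition row_perm :: "(nat \<times> nat \<Rightarrow> nat \<times> nat) \<Rightarrow> nat \<Rightarrow> nat" where
  "row_perm \<theta> j = snd (\<theta> (1, j))"

section \<open>Well-definedness\<close>

lemma word_cong_words:
  assumes "\<theta> permutes {1..m} \<times> {1..n}" "word_cong m n \<theta> x y"
  shows "x \<in> gen_words m n \<and> y \<in> gen_words m n"
  using assms(2)
proof induction
  case (word_cong_comm i j i' j')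
  then have "(i', j') \<in> {1..m} \<times> {1..n}"
    using permutes_in_image[OF assms(1), of "(i, j)"] by auto
  with word_cong_comm show ?case by (auto simp: gen_words_def)
qed (auto simp: gen_words_def)

lemma equiv_word_rel:
  assumes "\<theta> permutes {1..m} \<times> {1..n}"
  shows "equiv (gen_words m n) (word_rel m n \<theta>)"
proof (rule equivI)
  show "word_rel m n \<theta> \<subseteq> gen_words m n \<times> gen_words m n"
    using word_cong_words[OF assms] by (auto simp: word_rel_def)
  show "refl_on (gen_words m n) (word_rel m n \<theta>)"
    by (simp add: refl_on_def word_rel_def word_cong_refl)
  show "sym (word_rel m n \<theta>)"
    by (rule symI) (unfold word_rel_def, blast dest: word_cong_sym)
  show "trans (word_rel m n \<theta>)"
    by (rule transI) (unfold word_rel_def, blast dest: word_cong_trans)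
qed

lemma Fplus_mult_class:
  assumes \<theta>: "\<theta> permutes {1..m} \<times> {1..n}" and x: "x \<in> gen_words m n" and y: "y \<in> gen_words m n"
  shows "word_rel m n \<theta> `` {x} \<otimes>\<^bsub>Fplus m n \<theta>\<^esub> word_rel m n \<theta> `` {y} = word_rel m n \<theta> `` {x @ y}"
proof -
  have "word_rel m n \<theta> `` {x' @ y'} = word_rel m n \<theta> `` {x @ y}"
    if "word_cong m n \<theta> x x'" "word_cong m n \<theta> y y'" for x' y'
    by (rule equiv_class_eq[OF equiv_word_rel[OF \<theta>]])
       (simp add: word_rel_def word_cong_sym[OF word_cong_app[OF that]])
  then have "(\<Union>x'\<in>word_rel m n \<theta> `` {x}. \<Union>y'\<in>word_rel m n \<theta> `` {y}. word_rel m n \<theta> `` {x' @ y'})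
      = (\<Union>x'\<in>word_rel m n \<theta> `` {x}. \<Union>y'\<in>word_rel m n \<theta> `` {y}. word_rel m n \<theta> `` {x @ y})"
    by (auto simp: word_rel_def)
  also have "\<dots> = word_rel m n \<theta> `` {x @ y}"
    using x y by (auto simp: word_rel_def intro: word_cong_refl)
  finally show ?thesis by (simp add: Fplus_def)
qed

lemma monoid_Fplus:
  assumes \<theta>: "\<theta> permutes {1..m} \<times> {1..n}"
  shows "monoid (Fplus m n \<theta>)"
proof -
  have car: "A \<in> carrier (Fplus m n \<theta>) \<longleftrightarrow> (\<exists>x\<in>gen_words m n. A = word_rel m n \<theta> `` {x})" for A
    by (auto simp: Fplus_def quotient_def)
  have one: "\<one>\<^bsub>Fplus m n \<theta>\<^esub> = word_rel m n \<theta> `` {[]}" by (simp add: Fplus_def)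
  have app: "x @ y \<in> gen_words m n" if "x \<in> gen_words m n" "y \<in> gen_words m n" for x y
    using that by (auto simp: gen_words_def)
  have nil: "[] \<in> gen_words m n" by (simp add: gen_words_def)
  show ?thesis
    by (rule monoidI) (auto simp: car one Fplus_mult_class[OF \<theta>] app nil)
qed

lemma Fplus_relation:
  assumes \<theta>: "\<theta> permutes {1..m} \<times> {1..n}" and ij: "i \<in> {1..m}" "j \<in> {1..n}"
    and eq: "\<theta> (i, j) = (i', j')"
  shows "e_gen m n \<theta> i \<otimes>\<^bsub>Fplus m n \<theta>\<^esub> f_gen m n \<theta> j = f_gen m n \<theta> j' \<otimes>\<^bsub>Fplus m n \<theta>\<^esub> e_gen m n \<theta> i'"
proof -
  have ij': "i' \<in> {1..m}" "j' \<in> {1..n}"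
    using permutes_in_image[OF \<theta>, of "(i, j)"] ij eq by auto
  have "word_cong m n \<theta> [Egen i, Fgen j] [Fgen j', Egen i']"
    by (rule word_cong_comm[where \<theta> = \<theta>]) (fact ij eq)+
  then have "word_rel m n \<theta> `` {[Egen i, Fgen j]} = word_rel m n \<theta> `` {[Fgen j', Egen i']}"
    by (intro equiv_class_eq[OF equiv_word_rel[OF \<theta>]]) (simp add: word_rel_def)
  then show ?thesis
    using ij ij' by (simp add: e_gen_def f_gen_def Fplus_mult_class[OF \<theta>] gen_words_def)
qed

lemma word_cong_degree: "word_cong m n \<theta> x y \<Longrightarrow> word_degree x = word_degree y"
  by (induction rule: word_cong.induct) (auto simp: word_degree_def)

lemma degree_class:
  assumes "x \<in> gen_words m n"
  shows "degree (word_rel m n \<theta> `` {x}) = word_degree x"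
proof -
  have "word_degree y = word_degree x" if "word_cong m n \<theta> x y" for y
    using word_cong_degree[OF that] by (rule sym)
  moreover have "word_cong m n \<theta> x x" using assms by (rule word_cong_refl)
  ultimately have "word_degree ` (word_rel m n \<theta> `` {x}) = {word_degree x}"
    unfolding word_rel_def by blast
  then show ?thesis by (simp add: degree_def)
qed

lemma row_perm_permutes:
  assumes \<theta>: "\<theta> permutes {1..1} \<times> {1..n}"
  shows "row_perm \<theta> permutes {1..n}"
proof (rule bij_imp_permutes)
  have row: "\<theta> (1, j) = (1, row_perm \<theta> j) \<and> row_perm \<theta> j \<in> {1..n}" if "j \<in> {1..n}" for j
  proof -
    have "\<theta> (1, j) \<in> {1..1} \<times> {1..n}"
      using permutes_in_image[OF \<theta>] that by simp
    then show ?thesis unfolding row_perm_def by (cases "\<theta> (1, j)") simp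
  qed
  have "inj_on (row_perm \<theta>) {1..n}"
  proof (rule inj_onI)
    fix j k assume jk: "j \<in> {1..n}" "k \<in> {1..n}" "row_perm \<theta> j = row_perm \<theta> k"
    then have "\<theta> (1, j) = \<theta> (1, k)" by (metis row)
    then have "(1::nat, j) = (1, k)" by (rule injD[OF permutes_inj[OF \<theta>]])
    then show "j = k" by simp
  qed
  moreover have "row_perm \<theta> ` {1..n} \<subseteq> {1..n}" using row by blast
  ultimately show "bij_betw (row_perm \<theta>) {1..n} {1..n}"
    by (simp add: bij_betw_def endo_inj_surj)
  show "row_perm \<theta> j = j" if "j \<notin> {1..n}" for j
    using permutes_not_in[OF \<theta>, of "(1, j)"] that by (simp add: row_perm_def)
qed

end

theory Submission
  imports Defs
begin

text \<open>
  A tail with its integer data is a tiling of the quarter plane. At the point \<open>(k, l)\<close>, that is at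
  \<open>s = -k\<close>, \<open>t = -l\<close>, an edge \<open>e\<^sub>i\<close> leaves to \<open>(k + 1, l)\<close> and an edge \<open>f\<^sub>j\<close> to \<open>(k, l + 1)\<close>, and
  the four edges of a unit square satisfy the defining relation \<open>e\<^sub>i f\<^sub>j = f\<^sub>j\<^sub>' e\<^sub>i\<^sub>'\<close>. Such tilings
  (\<^emph>\<open>grids\<close>) replace infinite words throughout. A word acts on grids by being prepended, and this
  action is compatible with the relations (\<open>act_cong\<close>). Two words of the same degree that agree on
  one grid are congruent (\<open>act_faithful\<close>): bring both into the form \<open>e\<^sub>u f\<^sub>v\<close> and read the letters off
  the grid. Existence and uniqueness of factorizations follow, hence the integer data of a tail
  are exactly the labels of the grid with that tail on its staircase (\<open>int_data_tail_of\<close>).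
  In this language a tail is \<open>(a, -b)\<close>-periodic if and only if cutting off the first \<open>a\<close> columns of
  its grid leaves the same grid as cutting off the first \<open>b\<close> rows.

  Eventual periodicity of all tails implies periodicity because a failure of periodicity is visible
  in a finite prefix; repeating this prefix forever repeats the failure arbitrarily far out
  (\<open>eventually_periodic_imp_periodic\<close>).

  Suppose that all grids are periodic. If \<open>e\<^sub>u Y = f\<^sub>v Y'\<close> with \<open>|u| = a\<close> and \<open>|v| = b\<close>, then
  \<open>Y = Y'\<close>. From a refactorization \<open>e\<^sub>u f\<^sub>v = f\<^sub>v\<^sub>' e\<^sub>u\<^sub>'\<close> applied to \<open>Y\<close> one gets \<open>f\<^sub>v Y = e\<^sub>u\<^sub>' Y\<close>, where
  \<open>u'\<close> does not depend on \<open>Y\<close>. So the relation "\<open>e\<^sub>u Y = f\<^sub>v Y\<close> for all \<open>Y\<close>" is the graph of a bijection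
  \<open>\<gamma>\<close>, and \<open>e\<^sub>u f\<^sub>v Y = f\<^sub>\<gamma>\<^sub>u e\<^sub>\<gamma>\<^sup>-\<^sup>1\<^sub>v Y\<close> is immediate (\<open>periodic_imp_intertwines\<close>). Conversely, the
  commutation rule for \<open>\<gamma>\<close> implies that \<open>e\<^sub>u Y\<close> and \<open>f\<^sub>\<gamma>\<^sub>u Y\<close> have arbitrarily long common prefixes
  (\<open>intertwines_common_prefix\<close>), so they are equal, and periodicity follows
  (\<open>intertwines_imp_periodic\<close>).

  If \<open>m = 1\<close>, the square relation says that moving one step to the left in a grid applies the
  permutation \<open>\<theta>\<close> to the labels \<open>j\<close>; after as many steps as the order of \<open>\<theta>\<close> the labels return.
\<close>

section \<open>Words and their degrees\<close>

lemma gen_words_simps [simp]: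
  "[] \<in> gen_words m n"
  "Egen i # x \<in> gen_words m n \<longleftrightarrow> i \<in> {1..m} \<and> x \<in> gen_words m n"
  "Fgen j # x \<in> gen_words m n \<longleftrightarrow> j \<in> {1..n} \<and> x \<in> gen_words m n"
  "x @ y \<in> gen_words m n \<longleftrightarrow> x \<in> gen_words m n \<and> y \<in> gen_words m n"
  by (auto simp: gen_words_def)

lemma map_gen_words:
  "map Egen u \<in> gen_words m n \<longleftrightarrow> set u \<subseteq> {1..m}"
  "map Fgen v \<in> gen_words m n \<longleftrightarrow> set v \<subseteq> {1..n}"
  by (induction u, simp_all) (induction v, simp_all)

lemma word_degree_simps [simp]:
  "word_degree [] = (0, 0)"
  "word_degree (Egen i # x) = (Suc (fst (word_degree x)), snd (word_degree x))"
  "word_degree (Fgen j # x) = (fst (word_degree x), Suc (snd (word_degree x)))"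
  "word_degree (x @ y) =
     (fst (word_degree x) + fst (word_degree y), snd (word_degree x) + snd (word_degree y))"
  by (auto simp: word_degree_def)

lemma word_degree_map [simp]:
  "word_degree (map Egen u) = (length u, 0)"
  "word_degree (map Fgen v) = (0, length v)"
  by (induction u, simp_all) (induction v, simp_all)

lemma word_degree_no_f:
  assumes "x \<in> gen_words m n" "word_degree x = (k, 0)"
  obtains u where "x = map Egen u" "u \<in> tuples m k"
proof -
  have "\<exists>u. x = map Egen u \<and> u \<in> tuples m k"
    using assms
  proof (induction x arbitrary: k)
    case Nil then show ?case by (auto simp: tuples_def)
  next
    case (Cons c x)
    show ?case
    proof (cases c)
      case (Egen i)
      with Cons.prems have "i \<in> {1..m}" "x \<in> gen_words m n" "word_degree x = (k - 1, 0)" "0 < k"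
        by (auto simp: prod_eq_iff)
      moreover from this Cons.IH obtain u where "x = map Egen u" "u \<in> tuples m (k - 1)" by blast
      ultimately have "c # x = map Egen (i # u)" "i # u \<in> tuples m k"
        using Egen by (auto simp: tuples_def)
      then show ?thesis by (intro exI conjI)
    qed (use Cons.prems in simp)
  qed
  with that show ?thesis by blast
qed

lemma word_degree_no_e:
  assumes "x \<in> gen_words m n" "word_degree x = (0, l)"
  obtains v where "x = map Fgen v" "v \<in> tuples n l"
proof -
  have "\<exists>v. x = map Fgen v \<and> v \<in> tuples n l"
    using assms
  proof (induction x arbitrary: l)
    case Nil then show ?case by (auto simp: tuples_def)
  next
    case (Cons c x)
    show ?case
    proof (cases c)
      case (Fgen j)
      with Cons.prems have "j \<in> {1..n}" "x \<in> gen_words m n" "word_degree x = (0, l - 1)" "0 < l"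
        by (auto simp: prod_eq_iff)
      moreover from this Cons.IH obtain v where "x = map Fgen v" "v \<in> tuples n (l - 1)" by blast
      ultimately have "c # x = map Fgen (j # v)" "j # v \<in> tuples n l"
        using Fgen by (auto simp: tuples_def)
      then show ?thesis by (intro exI conjI)
    qed (use Cons.prems in simp)
  qed
  with that show ?thesis by blast
qed

section \<open>Grids and the action of words on them\<close>

text \<open>
  \<open>G k l\<close> is the pair of the label of the horizontal edge (a generator \<open>e\<close>) and the label of the
  vertical edge (a generator \<open>f\<close>) that leave the point \<open>(k, l)\<close>.
\<close>

type_synonym grid = "nat \<Rightarrow> nat \<Rightarrow> nat \<times> nat"

definition shift :: "nat \<Rightarrow> nat \<Rightarrow> grid \<Rightarrow> grid" where
  "shift p q G = (\<lambda>k l. G (k + p) (l + q))"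

lemma shift_apply [simp]: "shift p q G k l = G (k + p) (l + q)"
  by (simp add: shift_def)

lemma shift_0 [simp]: "shift 0 0 G = G"
  by (simp add: shift_def)

lemma shift_shift [simp]: "shift p q (shift r s G) = shift (p + r) (q + s) G"
  by (simp add: shift_def add.assoc)

locale one_vertex_2graph =
  fixes m n :: nat and \<theta> :: "nat \<times> nat \<Rightarrow> nat \<times> nat"
  assumes theta: "\<theta> permutes {1..m} \<times> {1..n}"
begin

abbreviation cong :: "letter list \<Rightarrow> letter list \<Rightarrow> bool" (infix "\<simeq>" 50) where
  "x \<simeq> y \<equiv> word_cong m n \<theta> x y"

text \<open>
  The two paths around the unit square at \<open>(k, l)\<close> spell \<open>e\<^sub>i f\<^sub>j\<close> and \<open>f\<^sub>j\<^sub>' e\<^sub>i\<^sub>'\<close>, whence the equation.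
\<close>

definition valid_grid :: "grid \<Rightarrow> bool" where
  "valid_grid G \<longleftrightarrow>
     (\<forall>k l. G k l \<in> {1..m} \<times> {1..n} \<and>
        \<theta> (fst (G k l), snd (G (Suc k) l)) = (fst (G k (Suc l)), snd (G k l)))"

lemma valid_shift [simp]: "valid_grid G \<Longrightarrow> valid_grid (shift p q G)"
  by (simp add: valid_grid_def)

lemma valid_range:
  assumes "valid_grid G"
  shows "fst (G k l) \<in> {1..m}" "snd (G k l) \<in> {1..n}"
proof -
  have "G k l \<in> {1..m} \<times> {1..n}" using assms unfolding valid_grid_def by blast
  then show "fst (G k l) \<in> {1..m}" "snd (G k l) \<in> {1..n}" by auto
qed

lemma valid_square:
  "valid_grid G \<Longrightarrow> \<theta> (fst (G k l), snd (G (Suc k) l)) = (fst (G k (Suc l)), snd (G k l))"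
  by (simp add: valid_grid_def)

lemma valid_square_inv:
  "valid_grid G \<Longrightarrow>
     inv' \<theta> (fst (G k (Suc l)), snd (G k l)) = (fst (G k l), snd (G (Suc k) l))"
  using valid_square permutes_inv_eq[OF theta] by metis

lemma theta_range:
  assumes "i \<in> {1..m}" "j \<in> {1..n}"
  shows "fst (\<theta> (i, j)) \<in> {1..m}" "snd (\<theta> (i, j)) \<in> {1..n}"
  using permutes_in_image[OF theta, of "(i, j)"] assms by (cases "\<theta> (i, j)"; simp)+

lemma inv_theta_range:
  assumes "i \<in> {1..m}" "j \<in> {1..n}"
  shows "fst (inv' \<theta> (i, j)) \<in> {1..m}" "snd (inv' \<theta> (i, j)) \<in> {1..n}"
  using permutes_in_image[OF permutes_inv[OF theta], of "(i, j)"] assms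
  by (cases "inv' \<theta> (i, j)"; simp)+

text \<open>
  A horizontal edge at the origin determines a whole new column to the left of a grid: in each
  square the bottom and right edges are known and \<open>\<theta>\<close> yields the top and left ones. Likewise a
  vertical edge determines a new bottom row, by means of the inverse of \<open>\<theta>\<close>.
\<close>

primrec new_column :: "nat \<Rightarrow> grid \<Rightarrow> nat \<Rightarrow> nat" where
  "new_column i G 0 = i"
| "new_column i G (Suc l) = fst (\<theta> (new_column i G l, snd (G 0 l)))"

definition prepend_e :: "nat \<Rightarrow> grid \<Rightarrow> grid" where
  "prepend_e i G = (\<lambda>k l. case k of
      0 \<Rightarrow> (new_column i G l, snd (\<theta> (new_column i G l, snd (G 0 l)))) | Suc k' \<Rightarrow> G k' l)"

primrec new_row :: "nat \<Rightarrow> grid \<Rightarrow> nat \<Rightarrow> nat" where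
  "new_row j G 0 = j"
| "new_row j G (Suc k) = snd (inv' \<theta> (fst (G k 0), new_row j G k))"

definition prepend_f :: "nat \<Rightarrow> grid \<Rightarrow> grid" where
  "prepend_f j G = (\<lambda>k l. case l of
      0 \<Rightarrow> (fst (inv' \<theta> (fst (G k 0), new_row j G k)), new_row j G k) | Suc l' \<Rightarrow> G k l')"

lemma prepend_e_simps [simp]:
  "shift (Suc 0) 0 (prepend_e i G) = G" "fst (prepend_e i G 0 0) = i"
  by (simp_all add: prepend_e_def shift_def)

lemma prepend_f_simps [simp]:
  "shift 0 (Suc 0) (prepend_f j G) = G" "snd (prepend_f j G 0 0) = j"
  by (simp_all add: prepend_f_def shift_def)

lemma valid_prepend_e:
  assumes G: "valid_grid G" and i: "i \<in> {1..m}"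
  shows "valid_grid (prepend_e i G)"
proof -
  have col: "new_column i G l \<in> {1..m}" for l
    by (induction l) (use i theta_range valid_range[OF G] in auto)
  have "prepend_e i G k l \<in> {1..m} \<times> {1..n}" for k l
    using theta_range[OF col valid_range(2)[OF G]] col valid_range[OF G]
    by (cases k) (auto simp: prepend_e_def mem_Times_iff)
  moreover have "\<theta> (fst (prepend_e i G k l), snd (prepend_e i G (Suc k) l)) =
      (fst (prepend_e i G k (Suc l)), snd (prepend_e i G k l))" for k l
    using valid_square[OF G] by (cases k) (auto simp: prepend_e_def)
  ultimately show ?thesis by (simp add: valid_grid_def)
qed

lemma valid_prepend_f:
  assumes G: "valid_grid G" and j: "j \<in> {1..n}"
  shows "valid_grid (prepend_f j G)"
proof -
  have row: "new_row j G k \<in> {1..n}" for k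
    by (induction k) (use j inv_theta_range valid_range[OF G] in auto)
  have "prepend_f j G k l \<in> {1..m} \<times> {1..n}" for k l
    using inv_theta_range[OF valid_range(1)[OF G] row] row valid_range[OF G]
    by (cases l) (auto simp: prepend_f_def mem_Times_iff)
  moreover have "\<theta> (fst (prepend_f j G k l), snd (prepend_f j G (Suc k) l)) =
      (fst (prepend_f j G k (Suc l)), snd (prepend_f j G k l))" for k l
    using valid_square[OF G] permutes_inverses(1)[OF theta]
    by (cases l) (auto simp: prepend_f_def)
  ultimately show ?thesis by (simp add: valid_grid_def)
qed

lemma prepend_e_unique:
  assumes H: "valid_grid H"
  shows "prepend_e (fst (H 0 0)) (shift 1 0 H) = H"
proof -
  have col: "new_column (fst (H 0 0)) (shift 1 0 H) l = fst (H 0 l)" for l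
    by (induction l) (simp_all add: valid_square[OF H])
  have "prepend_e (fst (H 0 0)) (shift 1 0 H) k l = H k l" for k l
    by (cases k) (simp_all add: prepend_e_def col[unfolded One_nat_def] valid_square[OF H])
  then show ?thesis by blast
qed

lemma prepend_f_unique:
  assumes H: "valid_grid H"
  shows "prepend_f (snd (H 0 0)) (shift 0 1 H) = H"
proof -
  have row: "new_row (snd (H 0 0)) (shift 0 1 H) k = snd (H k 0)" for k
    by (induction k) (simp_all add: valid_square_inv[OF H])
  have "prepend_f (snd (H 0 0)) (shift 0 1 H) k l = H k l" for k l
    by (cases l) (simp_all add: prepend_f_def row[unfolded One_nat_def] valid_square_inv[OF H])
  then show ?thesis by blast
qed

text \<open>
  Both grids have \<open>G\<close> as their part beyond \<open>(1, 1)\<close>, and the square at the origin is fixed by the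
  relation; a valid grid is determined by such data.
\<close>

lemma prepend_commute:
  assumes G: "valid_grid G" and ij: "i \<in> {1..m}" "j \<in> {1..n}" and eq: "\<theta> (i, j) = (i', j')"
  shows "prepend_e i (prepend_f j G) = prepend_f j' (prepend_e i' G)"
proof -
  define H where "H = prepend_e i (prepend_f j G)"
  have H: "valid_grid H"
    unfolding H_def using G ij valid_prepend_e valid_prepend_f by blast
  have "\<theta> (fst (H 0 0), snd (H (Suc 0) 0)) = (i', j')"
    using eq prepend_f_simps(2)[of j G] by (simp add: H_def prepend_e_def)
  then have corner: "fst (H 0 (Suc 0)) = i'" "snd (H 0 0) = j'"
    using valid_square[OF H, of 0 0] by auto
  have "shift 1 0 (shift 0 1 H) = shift 0 1 (shift 1 0 H)" by simp
  also have "\<dots> = G" by (simp only: H_def prepend_e_simps prepend_f_simps One_nat_def)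
  finally have "shift 0 1 H = prepend_e i' G"
    using prepend_e_unique[of "shift 0 1 H"] H corner by simp
  with prepend_f_unique[OF H] corner show ?thesis by (simp add: H_def)
qed

primrec act :: "letter list \<Rightarrow> grid \<Rightarrow> grid" where
  "act [] G = G"
| "act (c # x) G = (case c of Egen i \<Rightarrow> prepend_e i (act x G) | Fgen j \<Rightarrow> prepend_f j (act x G))"

lemma act_append [simp]: "act (x @ y) G = act x (act y G)"
  by (induction x) (auto split: letter.split)

lemma valid_act [simp]: "x \<in> gen_words m n \<Longrightarrow> valid_grid G \<Longrightarrow> valid_grid (act x G)"
proof (induction x)
  case (Cons c x) then show ?case by (cases c) (auto simp: valid_prepend_e valid_prepend_f)
qed simp

lemma shift_act:
  assumes "word_degree x = (k, l)"
  shows "shift k l (act x G) = G"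
  using assms
proof (induction x arbitrary: k l)
  case (Cons c x)
  show ?case
  proof (cases c)
    case (Egen i)
    with Cons.prems obtain k' where k: "k = Suc k'" "word_degree x = (k', l)"
      by (auto simp: prod_eq_iff)
    have "shift k l (act (c # x) G) = shift k' l (shift (Suc 0) 0 (act (c # x) G))"
      by (simp add: k)
    also have "\<dots> = G" by (simp only: Egen act.simps letter.case prepend_e_simps Cons.IH[OF k(2)])
    finally show ?thesis .
  next
    case (Fgen j)
    with Cons.prems obtain l' where l: "l = Suc l'" "word_degree x = (k, l')"
      by (auto simp: prod_eq_iff)
    have "shift k l (act (c # x) G) = shift k l' (shift 0 (Suc 0) (act (c # x) G))"
      by (simp add: l)
    also have "\<dots> = G" by (simp only: Fgen act.simps letter.case prepend_f_simps Cons.IH[OF l(2)])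
    finally show ?thesis .
  qed
qed simp

lemma act_cong:
  assumes "x \<simeq> y" "valid_grid G"
  shows "act x G = act y G"
  using assms
proof (induction arbitrary: G)
  case (word_cong_comm i j i' j')
  then show ?case by (simp add: prepend_commute)
next
  case (word_cong_app x y x' y')
  then show ?case using word_cong_words[OF theta word_cong_app.hyps(2)] by simp
qed auto

lemma act_e_inject:
  assumes "length u = length u'" "act (map Egen u) G = act (map Egen u') G'"
  shows "u = u'" "G = G'"
proof -
  have "u = u' \<and> G = G'" using assms
  proof (induction u u' rule: list_induct2)
    case (Cons i u i' u')
    then have eq: "prepend_e i (act (map Egen u) G) = prepend_e i' (act (map Egen u') G')"
      by simp
    then have "i = i'" by (metis prepend_e_simps(2))
    moreover from eq have "act (map Egen u) G = act (map Egen u') G'" by (metis prepend_e_simps(1))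
    ultimately show ?case using Cons.IH by simp
  qed simp
  then show "u = u'" "G = G'" by auto
qed

lemma act_f_inject:
  assumes "length v = length v'" "act (map Fgen v) G = act (map Fgen v') G'"
  shows "v = v'" "G = G'"
proof -
  have "v = v' \<and> G = G'" using assms
  proof (induction v v' rule: list_induct2)
    case (Cons j v j' v')
    then have eq: "prepend_f j (act (map Fgen v) G) = prepend_f j' (act (map Fgen v') G')"
      by simp
    then have "j = j'" by (metis prepend_f_simps(2))
    moreover from eq have "act (map Fgen v) G = act (map Fgen v') G'" by (metis prepend_f_simps(1))
    ultimately show ?case using Cons.IH by simp
  qed simp
  then show "v = v'" "G = G'" by auto
qed

section \<open>Unique factorization\<close>

text \<open>
  Since \<open>\<theta>\<close> is surjective, every product \<open>f\<^sub>j e\<^sub>i\<close> is the right-hand side of a defining relation.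
\<close>

lemma move_f_right:
  assumes "j \<in> {1..n}" "set u \<subseteq> {1..m}"
  shows "\<exists>u' j'. set u' \<subseteq> {1..m} \<and> j' \<in> {1..n} \<and>
           Fgen j # map Egen u \<simeq> map Egen u' @ [Fgen j']"
  using assms
proof (induction u arbitrary: j)
  case Nil
  then have "Fgen j # map Egen [] \<simeq> map Egen [] @ [Fgen j]" by (simp add: word_cong_refl)
  with Nil show ?case by (metis list.set(1) empty_subsetI)
next
  case (Cons i u)
  obtain i1 j1 where inv: "inv' \<theta> (i, j) = (i1, j1)" by (cases "inv' \<theta> (i, j)")
  then have r1: "i1 \<in> {1..m}" "j1 \<in> {1..n}"
    using inv_theta_range[of i j] Cons.prems by auto
  have "\<theta> (i1, j1) = (i, j)" using inv permutes_inv_eq[OF theta] by metis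
  then have "[Egen i1, Fgen j1] \<simeq> [Fgen j, Egen i]" by (rule word_cong_comm[OF r1])
  then have "[Fgen j, Egen i] @ map Egen u \<simeq> [Egen i1, Fgen j1] @ map Egen u"
    using Cons.prems by (intro word_cong_app word_cong_refl) (auto simp: map_gen_words intro: word_cong_sym)
  moreover obtain u' j' where u': "set u' \<subseteq> {1..m}" "j' \<in> {1..n}"
      "Fgen j1 # map Egen u \<simeq> map Egen u' @ [Fgen j']"
    using Cons.IH[of j1] r1 Cons.prems by auto
  then have "[Egen i1] @ (Fgen j1 # map Egen u) \<simeq> [Egen i1] @ (map Egen u' @ [Fgen j'])"
    using r1 by (intro word_cong_app word_cong_refl) (auto simp: map_gen_words)
  ultimately have "Fgen j # map Egen (i # u) \<simeq> map Egen (i1 # u') @ [Fgen j']"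
    using word_cong_trans by fastforce
  moreover have "set (i1 # u') \<subseteq> {1..m}" using u' r1 by simp
  ultimately show ?case using u'(2) by blast
qed

lemma normal_form:
  assumes "x \<in> gen_words m n"
  shows "\<exists>u v. set u \<subseteq> {1..m} \<and> set v \<subseteq> {1..n} \<and> x \<simeq> map Egen u @ map Fgen v"
  using assms
proof (induction x)
  case Nil
  have "[] \<simeq> map Egen [] @ map Fgen []" by (simp add: word_cong_refl)
  then show ?case by (metis list.set(1) empty_subsetI)
next
  case (Cons c x)
  have c: "[c] \<in> gen_words m n" and x: "x \<in> gen_words m n"
    using Cons.prems gen_words_simps(4)[of "[c]" x m n] by simp_all
  from Cons.IH[OF x] obtain u v
    where uv: "set u \<subseteq> {1..m}" "set v \<subseteq> {1..n}" "x \<simeq> map Egen u @ map Fgen v" by blast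
  have cx: "c # x \<simeq> [c] @ map Egen u @ map Fgen v"
    using word_cong_app[OF word_cong_refl[OF c] uv(3)] by simp
  show ?case
  proof (cases c)
    case (Egen i)
    with c cx uv have "set (i # u) \<subseteq> {1..m}" "c # x \<simeq> map Egen (i # u) @ map Fgen v" by auto
    with uv(2) show ?thesis by blast
  next
    case (Fgen j)
    with c have "j \<in> {1..n}" by simp
    then obtain u' j' where u': "set u' \<subseteq> {1..m}" "j' \<in> {1..n}"
        "Fgen j # map Egen u \<simeq> map Egen u' @ [Fgen j']"
      using move_f_right uv(1) by blast
    have "(Fgen j # map Egen u) @ map Fgen v \<simeq> (map Egen u' @ [Fgen j']) @ map Fgen v"
      using u'(3) uv(2) by (intro word_cong_app word_cong_refl) (auto simp: map_gen_words)
    with cx Fgen have "c # x \<simeq> map Egen u' @ map Fgen (j' # v)"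
      using word_cong_trans by fastforce
    moreover have "set (j' # v) \<subseteq> {1..n}" using u' uv by simp
    ultimately show ?thesis using u'(1) by blast
  qed
qed

text \<open>
  The letters of a normal form \<open>e\<^sub>u f\<^sub>v\<close> are visible in the bottom row of the grid and then in the
  column that follows it, so the grid determines the normal form once its degree is known.
\<close>

lemma act_faithful:
  assumes x: "x \<in> gen_words m n" and y: "y \<in> gen_words m n"
    and deg: "word_degree x = word_degree y"
    and G: "valid_grid G" and eq: "act x G = act y G"
  shows "x \<simeq> y"
proof -
  obtain u v where uv: "x \<simeq> map Egen u @ map Fgen v" using normal_form[OF x] by blast
  obtain u' v' where uv': "y \<simeq> map Egen u' @ map Fgen v'" using normal_form[OF y] by blast
  have len: "length u = length u'" "length v = length v'"
    using word_cong_degree[OF uv] word_cong_degree[OF uv'] deg by auto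
  have "act (map Egen u) (act (map Fgen v) G) = act (map Egen u') (act (map Fgen v') G)"
    using act_cong[OF uv G] act_cong[OF uv' G] eq by simp
  then have "u = u'" "v = v'" using len act_e_inject act_f_inject by blast+
  then show ?thesis using uv uv' word_cong_sym word_cong_trans by blast
qed

text \<open>
  Every lattice path from the origin to \<open>(k, l)\<close> spells such a word; the proof takes the path with
  the horizontal edges first.
\<close>

lemma exists_prefix:
  assumes "valid_grid G"
  shows "\<exists>x \<in> gen_words m n. word_degree x = (k, l) \<and> act x (shift k l G) = G"
  using assms
proof (induction k arbitrary: G)
  case 0
  then show ?case
  proof (induction l arbitrary: G)
    case 0
    show ?case by (rule bexI[of _ "[]"]) simp_all
  next
    case (Suc l)
    then obtain x where x: "x \<in> gen_words m n" "word_degree x = (0, l)"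
        "act x (shift 0 l (shift 0 1 G)) = shift 0 1 G"
      using Suc.IH[OF valid_shift[of G 0 1]] by blast
    have "act (Fgen (snd (G 0 0)) # x) (shift 0 (Suc l) G) = G"
      using x(3) prepend_f_unique[OF Suc.prems] by simp
    with x(1,2) valid_range[OF Suc.prems] show ?case
      by (intro bexI[of _ "Fgen (snd (G 0 0)) # x"]) (auto simp del: shift_apply)
  qed
next
  case (Suc k)
  then obtain x where x: "x \<in> gen_words m n" "word_degree x = (k, l)"
      "act x (shift k l (shift 1 0 G)) = shift 1 0 G"
    using Suc.IH[OF valid_shift[of G 1 0]] by blast
  have "act (Egen (fst (G 0 0)) # x) (shift (Suc k) l G) = G"
    using x(3) prepend_e_unique[OF Suc.prems] by simp
  with x(1,2) valid_range[OF Suc.prems] show ?case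
    by (intro bexI[of _ "Egen (fst (G 0 0)) # x"]) (auto simp del: shift_apply)
qed

text \<open>
  The condition on factorizations that defines the integer data, stated for words in place of
  their classes.
\<close>

definition reads_at :: "letter list \<Rightarrow> nat \<Rightarrow> nat \<Rightarrow> nat \<Rightarrow> nat \<Rightarrow> bool" where
  "reads_at x k l i j \<longleftrightarrow>
     (\<exists>x\<^sub>1 \<in> gen_words m n. \<exists>x\<^sub>2 \<in> gen_words m n. \<exists>x' \<in> gen_words m n. \<exists>x'' \<in> gen_words m n.
        x \<simeq> x\<^sub>1 @ x\<^sub>2 \<and> word_degree x\<^sub>1 = (k, l) \<and> x\<^sub>2 \<simeq> Egen i # x' \<and> x\<^sub>2 \<simeq> Fgen j # x'')"

lemma reads_at_act:
  assumes "reads_at x k l i j" and G: "valid_grid G"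
  shows "act x G k l = (i, j)"
proof -
  from assms(1) obtain x1 x2 x' x'' where x: "x \<simeq> x1 @ x2" "word_degree x1 = (k, l)"
      "x2 \<simeq> Egen i # x'" "x2 \<simeq> Fgen j # x''"
    unfolding reads_at_def by blast
  have "act x G k l = shift k l (act x G) 0 0" by simp
  also have "\<dots> = act x2 G 0 0" using act_cong[OF x(1) G] shift_act[OF x(2)] by simp
  also have "\<dots> = (i, j)"
  proof (rule prod_eqI)
    show "fst (act x2 G 0 0) = fst (i, j)" using act_cong[OF x(3) G] by simp
    show "snd (act x2 G 0 0) = snd (i, j)" using act_cong[OF x(4) G] by simp
  qed
  finally show ?thesis .
qed

text \<open>
  Three lattice paths in the grid provide the required words: one from the origin to \<open>(k, l)\<close>, and
  two from \<open>(k, l)\<close> to \<open>(c, d)\<close> that begin with a horizontal and with a vertical edge.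
  Faithfulness makes paths with common endpoints congruent.
\<close>

lemma act_reads_at:
  assumes x: "x \<in> gen_words m n" "word_degree x = (c, d)" and kl: "k < c" "l < d"
    and G: "valid_grid G"
  shows "reads_at x k l (fst (act x G k l)) (snd (act x G k l))"
proof -
  define H where "H = act x G"
  have H: "valid_grid H" unfolding H_def using x G by simp
  have HG: "shift c d H = G" unfolding H_def by (rule shift_act[OF x(2)])
  obtain x1 where x1: "x1 \<in> gen_words m n" "word_degree x1 = (k, l)" "act x1 (shift k l H) = H"
    using exists_prefix[OF H] by blast
  define K where "K = shift k l H"
  have K: "valid_grid K" unfolding K_def using H by simp
  obtain x' where x': "x' \<in> gen_words m n" "word_degree x' = (c - Suc k, d - l)"
      "act x' (shift (c - Suc k) (d - l) (shift 1 0 K)) = shift 1 0 K"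
    using exists_prefix[OF valid_shift[OF K]] by blast
  obtain x'' where x'': "x'' \<in> gen_words m n" "word_degree x'' = (c - k, d - Suc l)"
      "act x'' (shift (c - k) (d - Suc l) (shift 0 1 K)) = shift 0 1 K"
    using exists_prefix[OF valid_shift[OF K]] by blast
  have G': "act x' G = shift 1 0 K" "act x'' G = shift 0 1 K"
    using x'(3) x''(3) kl by (simp_all add: K_def HG)
  define e f where "e = Egen (fst (K 0 0)) # x'" and "f = Fgen (snd (K 0 0)) # x''"
  have ef: "e \<in> gen_words m n" "f \<in> gen_words m n"
    using x' x'' valid_range[OF K] by (auto simp: e_def f_def)
  have act_ef: "act e G = K" "act f G = K"
    using prepend_e_unique[OF K] prepend_f_unique[OF K] G' by (simp_all add: e_def f_def)
  have deg: "word_degree e = (c - k, d - l)" "word_degree f = (c - k, d - l)"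
    using x' x'' kl by (simp_all add: e_def f_def)
  have "e \<simeq> f" using act_faithful[OF ef _ G] deg act_ef by simp
  moreover have "x \<simeq> x1 @ e"
  proof (rule act_faithful[OF _ _ _ G])
    show "act x G = act (x1 @ e) G" using x1(3) by (simp add: act_ef K_def H_def)
  qed (use x x1 ef deg kl in auto)
  moreover have "e \<simeq> Egen (fst (K 0 0)) # x'" using ef by (simp add: e_def word_cong_refl)
  moreover have "K 0 0 = act x G k l" by (simp add: K_def H_def)
  ultimately show ?thesis
    unfolding reads_at_def f_def using x1 x' x'' ef by metis
qed

lemma prefix_determines:
  assumes "x \<in> gen_words m n" "word_degree x = (c, d)" "k < c" "l < d"
    and "valid_grid G" "valid_grid G'"
  shows "act x G k l = act x G' k l"
  using reads_at_act[OF act_reads_at[OF assms(1-5)] assms(6)] by simp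

section \<open>Tails as staircases of grids\<close>

definition stair :: "(nat \<Rightarrow> nat \<times> nat) \<Rightarrow> nat \<Rightarrow> letter list" where
  "stair \<tau> T = concat (map (\<lambda>k. [Egen (fst (\<tau> k)), Fgen (snd (\<tau> k))]) [0..<T])"

lemma stair_simps [simp]:
  "stair \<tau> 0 = []"
  "stair \<tau> (Suc T) = stair \<tau> T @ [Egen (fst (\<tau> T)), Fgen (snd (\<tau> T))]"
  by (simp_all add: stair_def)

lemma word_degree_stair [simp]: "word_degree (stair \<tau> T) = (T, T)"
  by (induction T) auto

lemma stair_words [simp]: "is_tail m n \<tau> \<Longrightarrow> stair \<tau> T \<in> gen_words m n"
proof (induction T)
  case (Suc T)
  then have "\<tau> T \<in> {1..m} \<times> {1..n}" by (simp add: is_tail_def)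
  with Suc show ?case by auto
qed simp

text \<open>
  The staircase \<open>(0,0), (1,0), (1,1), (2,1), \<dots>\<close> has its horizontal steps at the points \<open>(k, k)\<close> and
  its vertical steps at \<open>(k + 1, k)\<close>.
\<close>

definition tail_of :: "grid \<Rightarrow> nat \<Rightarrow> nat \<times> nat" where
  "tail_of G k = (fst (G k k), snd (G (Suc k) k))"

lemma is_tail_tail_of: "valid_grid G \<Longrightarrow> is_tail m n (tail_of G)"
  using valid_range by (simp add: is_tail_def tail_of_def)

lemma act_stair:
  assumes "valid_grid G"
  shows "act (stair (tail_of G) T) (shift T T G) = G"
proof (induction T)
  case (Suc T)
  define H where "H = shift T T G"
  have H: "valid_grid H" using assms by (simp add: H_def)
  have "prepend_f (snd (shift 1 0 H 0 0)) (shift 0 1 (shift 1 0 H)) = shift 1 0 H"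
    using prepend_f_unique[OF valid_shift[OF H, of 1 0]] .
  with prepend_e_unique[OF H]
  have "act [Egen (fst (tail_of G T)), Fgen (snd (tail_of G T))] (shift (Suc T) (Suc T) G) = H"
    by (simp add: H_def tail_of_def)
  with Suc show ?case by (simp add: H_def del: shift_apply)
qed simp

text \<open>
  The staircase determines all other labels, diagonal by diagonal. For a grid \<open>G\<close> with
  staircase \<open>\<tau>\<close>, the pair \<open>above \<tau> d k\<close> consists of the bottom and right edges of the unit square
  at \<open>(k, k + d)\<close>, to which \<open>\<theta>\<close> is applied to reach the next diagonal. The pair \<open>below \<tau> d l\<close>
  consists of the bottom and right edges of the square at \<open>(l + d, l)\<close>, which the inverse of \<open>\<theta>\<close>
  yields from its top and left edges.
\<close>

primrec above :: "(nat \<Rightarrow> nat \<times> nat) \<Rightarrow> nat \<Rightarrow> nat \<Rightarrow> nat \<times> nat" where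
  "above \<tau> 0 k = \<tau> k"
| "above \<tau> (Suc d) k = (fst (\<theta> (above \<tau> d k)), snd (\<theta> (above \<tau> d (Suc k))))"

primrec below :: "(nat \<Rightarrow> nat \<times> nat) \<Rightarrow> nat \<Rightarrow> nat \<Rightarrow> nat \<times> nat" where
  "below \<tau> 0 l = \<tau> l"
| "below \<tau> (Suc d) l = inv' \<theta> (fst (below \<tau> d (Suc l)), snd (below \<tau> d l))"

definition grid_of :: "(nat \<Rightarrow> nat \<times> nat) \<Rightarrow> grid" where
  "grid_of \<tau> k l =
     (if k \<le> l then fst (above \<tau> (l - k) k) else fst (below \<tau> (k - l) l),
      if k \<le> l then snd (\<theta> (above \<tau> (l - k) k)) else snd (below \<tau> (k - Suc l) l))"

lemma tail_of_grid_of: "tail_of (grid_of \<tau>) = \<tau>"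
  by (rule ext) (simp add: tail_of_def grid_of_def)

text \<open>
  The squares above the diagonal, on it and below it satisfy the relation for different reasons:
  the first two by the recursion for \<open>above\<close>, the last by that for \<open>below\<close>.
\<close>

lemma valid_grid_of:
  assumes "is_tail m n \<tau>"
  shows "valid_grid (grid_of \<tau>)"
proof -
  have tau: "\<tau> k \<in> {1..m} \<times> {1..n}" for k using assms by (simp add: is_tail_def)
  have th: "\<theta> p \<in> {1..m} \<times> {1..n} \<longleftrightarrow> p \<in> {1..m} \<times> {1..n}" for p
    by (rule permutes_in_image[OF theta])
  have ith: "inv' \<theta> p \<in> {1..m} \<times> {1..n} \<longleftrightarrow> p \<in> {1..m} \<times> {1..n}" for p
    by (rule permutes_in_image[OF permutes_inv[OF theta]])
  have A: "above \<tau> d k \<in> {1..m} \<times> {1..n}" for d k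
  proof (induction d arbitrary: k)
    case (Suc d)
    from th[of "above \<tau> d k"] th[of "above \<tau> d (Suc k)"] Suc[of k] Suc[of "Suc k"]
    show ?case by (simp add: mem_Times_iff)
  qed (use tau in simp)
  have B: "below \<tau> d k \<in> {1..m} \<times> {1..n}" for d k
  proof (induction d arbitrary: k)
    case (Suc d)
    from Suc[of k] Suc[of "Suc k"] show ?case
      using ith[of "(fst (below \<tau> d (Suc k)), snd (below \<tau> d k))"] by (simp add: mem_Times_iff)
  qed (use tau in simp)
  have "grid_of \<tau> k l \<in> {1..m} \<times> {1..n}" for k l
    using A B th[of "above \<tau> (l - k) k"] by (simp add: grid_of_def mem_Times_iff)
  moreover have "\<theta> (fst (grid_of \<tau> k l), snd (grid_of \<tau> (Suc k) l)) =
      (fst (grid_of \<tau> k (Suc l)), snd (grid_of \<tau> k l))" for k l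
  proof (cases k l rule: linorder_cases)
    case less
    then obtain d where l: "l = Suc (k + d)" using less_imp_Suc_add by auto
    have "snd (grid_of \<tau> (Suc k) l) = snd (above \<tau> (Suc d) k)"
      by (simp add: grid_of_def l)
    moreover have "fst (grid_of \<tau> k l) = fst (above \<tau> (Suc d) k)"
      using less by (simp add: grid_of_def l)
    ultimately have "\<theta> (fst (grid_of \<tau> k l), snd (grid_of \<tau> (Suc k) l)) = \<theta> (above \<tau> (Suc d) k)"
      by simp
    also have "\<dots> = (fst (above \<tau> (Suc (Suc d)) k), snd (\<theta> (above \<tau> (Suc d) k)))" by simp
    also have "\<dots> = (fst (grid_of \<tau> k (Suc l)), snd (grid_of \<tau> k l))"
      unfolding grid_of_def l by simp
    finally show ?thesis .
  next
    case equal
    then show ?thesis by (simp add: grid_of_def)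
  next
    case greater
    then obtain d where k: "k = Suc (l + d)" using less_imp_Suc_add by auto
    have up: "fst (grid_of \<tau> k (Suc l)) = fst (below \<tau> d (Suc l))"
      by (cases d) (simp_all add: grid_of_def k)
    have "\<theta> (fst (grid_of \<tau> k l), snd (grid_of \<tau> (Suc k) l)) = \<theta> (below \<tau> (Suc d) l)"
      by (simp add: grid_of_def k)
    also have "\<dots> = (fst (below \<tau> d (Suc l)), snd (below \<tau> d l))"
      using permutes_inverses(1)[OF theta] by simp
    also have "snd (below \<tau> d l) = snd (grid_of \<tau> k l)" by (simp add: grid_of_def k)
    finally show ?thesis by (simp add: up)
  qed
  ultimately show ?thesis by (simp add: valid_grid_def)
qed

section \<open>Periodicity of tails in terms of grids\<close>

definition word_class :: "letter list \<Rightarrow> letter list set" where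
  "word_class x = word_rel m n \<theta> `` {x}"

lemma carrier_word_class: "w \<in> carrier (Fplus m n \<theta>) \<longleftrightarrow> (\<exists>x \<in> gen_words m n. w = word_class x)"
  by (auto simp: Fplus_def quotient_def word_class_def)

lemma mult_word_class:
  "x \<in> gen_words m n \<Longrightarrow> y \<in> gen_words m n \<Longrightarrow> word_class x \<otimes>\<^bsub>Fplus m n \<theta>\<^esub> word_class y = word_class (x @ y)"
  unfolding word_class_def by (rule Fplus_mult_class[OF theta])

lemma one_word_class: "\<one>\<^bsub>Fplus m n \<theta>\<^esub> = word_class []"
  by (simp add: Fplus_def word_class_def)

lemma gen_word_class: "e_gen m n \<theta> i = word_class [Egen i]" "f_gen m n \<theta> j = word_class [Fgen j]"
  by (simp_all add: e_gen_def f_gen_def word_class_def)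

lemma word_class_eq_iff:
  assumes "x \<in> gen_words m n" "y \<in> gen_words m n"
  shows "word_class x = word_class y \<longleftrightarrow> x \<simeq> y"
  using eq_equiv_class_iff[OF equiv_word_rel[OF theta] assms] by (simp add: word_class_def word_rel_def)

lemma degree_word_class: "x \<in> gen_words m n \<Longrightarrow> degree (word_class x) = word_degree x"
  unfolding word_class_def by (rule degree_class)

lemma e_word_eq_class: "set u \<subseteq> {1..m} \<Longrightarrow> e_word m n \<theta> u = word_class (map Egen u)"
  by (induction u) (simp_all add: e_word_def one_word_class gen_word_class mult_word_class map_gen_words)

lemma f_word_eq_class: "set v \<subseteq> {1..n} \<Longrightarrow> f_word m n \<theta> v = word_class (map Fgen v)"
  by (induction v) (simp_all add: f_word_def one_word_class gen_word_class mult_word_class map_gen_words)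

lemma tail_prefix_word_class: "is_tail m n \<tau> \<Longrightarrow> tail_prefix m n \<theta> \<tau> T = word_class (stair \<tau> T)"
proof (induction T)
  case (Suc T)
  then have "\<tau> T \<in> {1..m} \<times> {1..n}" by (simp add: is_tail_def)
  with Suc show ?case by (auto simp: gen_word_class mult_word_class)
qed (simp add: one_word_class)

lemma int_data_eq_reads_at:
  assumes tau: "is_tail m n \<tau>"
  shows "int_data m n \<theta> \<tau> s t =
    (THE (i, j). i \<in> {1..m} \<and> j \<in> {1..n} \<and>
       (\<exists>T > max (nat \<bar>s\<bar>) (nat \<bar>t\<bar>). reads_at (stair \<tau> T) (nat \<bar>s\<bar>) (nat \<bar>t\<bar>) i j))"
proof -
  have "Bex (carrier (Fplus m n \<theta>)) Q \<longleftrightarrow> (\<exists>x \<in> gen_words m n. Q (word_class x))" for Q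
    using carrier_word_class by auto
  then show ?thesis
    unfolding int_data_def using tau stair_words[OF tau]
    by (simp add: reads_at_def tail_prefix_word_class gen_word_class mult_word_class degree_word_class word_class_eq_iff
        cong: bex_cong conj_cong)
qed

text \<open>
  A grid is the staircase word \<open>\<tau>\<^sub>T\<close> prepended to its part beyond \<open>(T, T)\<close>. So factorizations of
  \<open>\<tau>\<^sub>T\<close> can be read off the grid, and the grid forces the first letters in them.
\<close>

lemma int_data_tail_of:
  assumes G: "valid_grid G"
  shows "int_data m n \<theta> (tail_of G) s t = G (nat \<bar>s\<bar>) (nat \<bar>t\<bar>)"
proof -
  define k l where "k = nat \<bar>s\<bar>" and "l = nat \<bar>t\<bar>"
  define \<tau> where "\<tau> = tail_of G"
  have tau: "is_tail m n \<tau>" unfolding \<tau>_def by (rule is_tail_tail_of[OF G])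
  have G_stair: "act (stair \<tau> T) (shift T T G) = G" for T
    unfolding \<tau>_def by (rule act_stair[OF G])
  show ?thesis
    unfolding \<tau>_def[symmetric] int_data_eq_reads_at[OF tau] k_def[symmetric] l_def[symmetric]
  proof (rule the_equality)
    let ?T = "Suc (max k l)"
    have "reads_at (stair \<tau> ?T) k l (fst (G k l)) (snd (G k l))"
      using act_reads_at[OF stair_words[OF tau] word_degree_stair, of k ?T l "shift ?T ?T G"] G
      by (simp only: G_stair valid_shift)
    then show "case G k l of (i, j) \<Rightarrow> i \<in> {1..m} \<and> j \<in> {1..n} \<and>
        (\<exists>T > max k l. reads_at (stair \<tau> T) k l i j)"
      using valid_range[OF G, of k l] by (auto simp: case_prod_unfold intro!: exI[of _ ?T])
  next
    fix p
    assume "case p of (i, j) \<Rightarrow> i \<in> {1..m} \<and> j \<in> {1..n} \<and>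
        (\<exists>T > max k l. reads_at (stair \<tau> T) k l i j)"
    then obtain T where "reads_at (stair \<tau> T) k l (fst p) (snd p)" by auto
    then show "p = G k l"
      using reads_at_act[of "stair \<tau> T" k l "fst p" "snd p" "shift T T G"] G
      by (simp add: G_stair del: shift_apply)
  qed
qed

text \<open>
  Statements about all tails become statements about all grids, since every tail is the staircase
  of a grid.
\<close>

lemma all_tails_iff:
  "(\<forall>\<tau>. is_tail m n \<tau> \<longrightarrow> P \<tau>) \<longleftrightarrow> (\<forall>G. valid_grid G \<longrightarrow> P (tail_of G))"
  using is_tail_tail_of valid_grid_of tail_of_grid_of by metis

lemma periodic_tail_of:
  assumes G: "valid_grid G"
  shows "periodic_tail m n \<theta> (int a, - int b) (tail_of G) \<longleftrightarrow> shift a 0 G = shift 0 b G"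
proof
  assume L: "periodic_tail m n \<theta> (int a, - int b) (tail_of G)"
  have "G (k + a) l = G k (l + b)" for k l
  proof -
    have "int_data m n \<theta> (tail_of G) (- int (k + a) + int a) (- int l - int b) =
        int_data m n \<theta> (tail_of G) (- int (k + a)) (- int l)"
      using L[unfolded periodic_tail_def split_conv, rule_format, of "- int (k + a)" "- int l"]
      by simp
    moreover have "nat \<bar>- int (k + a) + int a\<bar> = k" "nat \<bar>- int l - int b\<bar> = l + b"
      "nat \<bar>- int (k + a)\<bar> = k + a" "nat \<bar>- int l\<bar> = l" by auto
    ultimately show ?thesis by (simp only: int_data_tail_of[OF G])
  qed
  then show "shift a 0 G = shift 0 b G" by (simp add: shift_def)
next
  assume "shift a 0 G = shift 0 b G"
  then have eq: "G (k + a) l = G k (l + b)" for k l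
    using shift_apply[of a 0 G k l] shift_apply[of 0 b G k l] by simp
  have "G (nat \<bar>s + int a\<bar>) (nat \<bar>t - int b\<bar>) = G (nat \<bar>s\<bar>) (nat \<bar>t\<bar>)"
    if "s \<le> 0" "t \<le> 0" "s + int a \<le> 0" for s t
  proof -
    have "nat \<bar>s\<bar> = nat \<bar>s + int a\<bar> + a" "nat \<bar>t - int b\<bar> = nat \<bar>t\<bar> + b" using that by auto
    then show ?thesis using eq by simp
  qed
  then show "periodic_tail m n \<theta> (int a, - int b) (tail_of G)"
    by (simp add: periodic_tail_def int_data_tail_of[OF G])
qed

lemma eventually_periodic_tail_of:
  assumes G: "valid_grid G"
  shows "eventually_periodic_tail m n \<theta> (int a, - int b) (tail_of G) \<longleftrightarrow>
     (\<exists>N. \<forall>k\<ge>N. \<forall>l\<ge>N. G (k + a) l = G k (l + b))"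
proof
  assume "eventually_periodic_tail m n \<theta> (int a, - int b) (tail_of G)"
  then have "\<exists>T\<le>0. \<forall>s\<le>T. \<forall>t\<le>T.
      G (nat \<bar>s + int a\<bar>) (nat \<bar>t - int b\<bar>) = G (nat \<bar>s\<bar>) (nat \<bar>t\<bar>)"
    unfolding eventually_periodic_tail_def split_conv int_data_tail_of[OF G]
      diff_conv_add_uminus by blast
  then obtain T where T: "T \<le> 0"
    "\<And>s t. s \<le> T \<Longrightarrow> t \<le> T \<Longrightarrow>
       G (nat \<bar>s + int a\<bar>) (nat \<bar>t - int b\<bar>) = G (nat \<bar>s\<bar>) (nat \<bar>t\<bar>)"
    by blast
  have "G (k + a) l = G k (l + b)" if "k \<ge> nat (- T)" "l \<ge> nat (- T)" for k l
  proof -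
    have "G (nat \<bar>- int (k + a) + int a\<bar>) (nat \<bar>- int l - int b\<bar>) =
        G (nat \<bar>- int (k + a)\<bar>) (nat \<bar>- int l\<bar>)"
      by (rule T(2)) (use that T(1) in auto)
    moreover have "nat \<bar>- int (k + a) + int a\<bar> = k" "nat \<bar>- int l - int b\<bar> = l + b"
      "nat \<bar>- int (k + a)\<bar> = k + a" "nat \<bar>- int l\<bar> = l" by auto
    ultimately show ?thesis by metis
  qed
  then show "\<exists>N. \<forall>k\<ge>N. \<forall>l\<ge>N. G (k + a) l = G k (l + b)" by blast
next
  assume "\<exists>N. \<forall>k\<ge>N. \<forall>l\<ge>N. G (k + a) l = G k (l + b)"
  then obtain N where N: "\<And>k l. k \<ge> N \<Longrightarrow> l \<ge> N \<Longrightarrow> G (k + a) l = G k (l + b)" by blast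
  have "G (nat \<bar>s + int a\<bar>) (nat \<bar>t - int b\<bar>) = G (nat \<bar>s\<bar>) (nat \<bar>t\<bar>)"
    if st: "s \<le> - int (N + a)" "t \<le> - int (N + a)" for s t
  proof -
    have "nat \<bar>s\<bar> = nat \<bar>s + int a\<bar> + a" "nat \<bar>t - int b\<bar> = nat \<bar>t\<bar> + b" using st by auto
    moreover have "N \<le> nat \<bar>s + int a\<bar>" "N \<le> nat \<bar>t\<bar>" using st by auto
    ultimately show ?thesis using N by simp
  qed
  then show "eventually_periodic_tail m n \<theta> (int a, - int b) (tail_of G)"
    unfolding eventually_periodic_tail_def split_conv int_data_tail_of[OF G]
      diff_conv_add_uminus
    by (intro exI[of _ "- int (N + a)"]) simp
qed

section \<open>From eventual periodicity to periodicity\<close>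

lemma stair_cong: "(\<And>k. k < T \<Longrightarrow> \<tau> k = \<sigma> k) \<Longrightarrow> stair \<tau> T = stair \<sigma> T"
  unfolding stair_def by (intro arg_cong[where f = concat] map_cong) auto

lemma grid_determined_by_tail:
  assumes G: "valid_grid G" and H: "valid_grid H"
    and eq: "\<And>k. k < T \<Longrightarrow> tail_of G k = tail_of H k" and kl: "k < T" "l < T"
  shows "G k l = H k l"
proof -
  have "stair (tail_of G) T \<in> gen_words m n" using is_tail_tail_of[OF G] by simp
  then have "act (stair (tail_of G) T) (shift T T G) k l =
      act (stair (tail_of G) T) (shift T T H) k l"
    using prefix_determines[OF _ word_degree_stair kl] G H valid_shift by blast
  moreover have "stair (tail_of G) T = stair (tail_of H) T" using eq by (rule stair_cong)
  ultimately show ?thesis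
    using act_stair[OF H, of T] act_stair[OF G, of T] by metis
qed

text \<open>
  If \<open>G\<close> violated periodicity at \<open>(k, l)\<close>, the first \<open>T\<close> letter pairs of its tail would show it.
  The tail \<open>\<sigma>\<close> that repeats these pairs with period \<open>T\<close> has a grid invariant under the diagonal shift
  by \<open>T\<close>, which would show the same violation at all \<open>(k + N T, l + N T)\<close>.
\<close>

lemma eventually_periodic_imp_periodic:
  assumes ev: "\<And>G. valid_grid G \<Longrightarrow> \<exists>N. \<forall>k\<ge>N. \<forall>l\<ge>N. G (k + a) l = G k (l + b)"
    and G: "valid_grid G"
  shows "shift a 0 G = shift 0 b G"
proof -
  have "G (k + a) l = G k (l + b)" for k l
  proof -
    \<comment> \<open>large enough for the square of side \<open>T\<close> to contain both \<open>(k + a, l)\<close> and \<open>(k, l + b)\<close>\<close>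
    define T where "T = Suc (k + a + l + b)"
    define \<sigma> where "\<sigma> r = tail_of G (r mod T)" for r
    define H where "H = grid_of \<sigma>"
    have "is_tail m n \<sigma>" using is_tail_tail_of[OF G] by (simp add: is_tail_def \<sigma>_def)
    then have H: "valid_grid H" unfolding H_def by (rule valid_grid_of)
    have tailH: "tail_of H = \<sigma>" unfolding H_def by (rule tail_of_grid_of)
    have HT: "H (r + N * T) (s + N * T) = H r s" for r s N
    proof -
      have "tail_of (shift (N * T) (N * T) H) c = tail_of H c" for c
      proof -
        have "tail_of (shift (N * T) (N * T) H) c = tail_of H (c + N * T)"
          by (simp add: tail_of_def)
        then show ?thesis by (simp add: tailH \<sigma>_def)
      qed
      then have "shift (N * T) (N * T) H r s = H r s"
        using grid_determined_by_tail[OF valid_shift[OF H] H,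
            where T = "Suc (r + s)" and k = r and l = s]
        by (simp del: shift_apply)
      then show ?thesis by simp
    qed
    obtain N where N: "\<And>r s. r \<ge> N \<Longrightarrow> s \<ge> N \<Longrightarrow> H (r + a) s = H r (s + b)"
      using ev[OF H] by blast
    have "N \<le> N * T" by (simp add: T_def)
    then have "H (k + N * T + a) (l + N * T) = H (k + N * T) (l + N * T + b)"
      by (intro N trans_le_add2)
    then have "H (k + a) l = H k (l + b)"
      using HT[of "k + a" N l] HT[of k N "l + b"] by (simp add: ac_simps)
    moreover have "G r s = H r s" if "r < T" "s < T" for r s
      using grid_determined_by_tail[OF G H _ that] by (simp add: tailH \<sigma>_def)
    ultimately show ?thesis by (simp add: T_def)
  qed
  then show ?thesis by (simp add: shift_def)
qed

section \<open>Periodicity and the bijection between words\<close>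

text \<open>
  In the grid \<open>act x G\<close>, follow lattice paths from the origin to \<open>(k, l)\<close> and on to
  \<open>(k + k', l + l')\<close>, where \<open>G\<close> begins.
\<close>

lemma exists_factorization:
  assumes G: "valid_grid G" and x: "x \<in> gen_words m n" "word_degree x = (k + k', l + l')"
  shows "\<exists>y \<in> gen_words m n. \<exists>z \<in> gen_words m n.
           word_degree y = (k, l) \<and> word_degree z = (k', l') \<and> x \<simeq> y @ z"
proof -
  have H: "valid_grid (act x G)" using x G by simp
  obtain y where y: "y \<in> gen_words m n" "word_degree y = (k, l)"
      "act y (shift k l (act x G)) = act x G"
    using exists_prefix[OF H] by blast
  obtain z where z: "z \<in> gen_words m n" "word_degree z = (k', l')"
      "act z (shift k' l' (shift k l (act x G))) = shift k l (act x G)"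
    using exists_prefix[OF valid_shift[OF H]] by blast
  have "shift k' l' (shift k l (act x G)) = G" using shift_act[OF x(2)] by (simp add: add.commute)
  then have "act (y @ z) G = act x G" using y z by (simp del: shift_shift)
  then have "x \<simeq> y @ z" using act_faithful[OF x(1) _ _ G, of "y @ z"] x(2) y z by simp
  then show ?thesis using y z by blast
qed

definition intertwines :: "nat \<Rightarrow> nat \<Rightarrow> (nat list \<Rightarrow> nat list) \<Rightarrow> bool" where
  "intertwines a b \<gamma> \<longleftrightarrow> bij_betw \<gamma> (tuples m a) (tuples n b) \<and>
     (\<forall>u \<in> tuples m a. \<forall>v \<in> tuples n b. map Egen u @ map Fgen v \<simeq>
        map Fgen (\<gamma> u) @ map Egen (inv_into (tuples m a) \<gamma> v))"

lemma tuples_gen_words [simp]: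
  "u \<in> tuples m a \<Longrightarrow> map Egen u \<in> gen_words m n"
  "v \<in> tuples n b \<Longrightarrow> map Fgen v \<in> gen_words m n"
  by (auto simp: tuples_def map_gen_words)

lemma length_tuples: "u \<in> tuples k a \<Longrightarrow> length u = a"
  by (simp add: tuples_def)

text \<open>
  The bijection relates \<open>u\<close> and \<open>v\<close> when prepending \<open>e\<^sub>u\<close> or \<open>f\<^sub>v\<close> has the same effect on every grid.
\<close>

lemma periodic_imp_intertwines:
  assumes G0: "valid_grid G\<^sub>0"
    and per: "\<And>G. valid_grid G \<Longrightarrow> shift a 0 G = shift 0 b G"
  shows "\<exists>\<gamma>. intertwines a b \<gamma>"
proof -
  define R where "R u v \<longleftrightarrow> u \<in> tuples m a \<and> v \<in> tuples n b \<and>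
      (\<forall>Y. valid_grid Y \<longrightarrow> act (map Egen u) Y = act (map Fgen v) Y)" for u v
  \<comment> \<open>This is where periodicity enters: it is applied to the grid on both sides of the equation.\<close>
  have same_rest: "Y = Y'"
    if "u \<in> tuples m a" "v \<in> tuples n b" "valid_grid Y"
      "act (map Egen u) Y = act (map Fgen v) Y'" for u v Y Y'
  proof -
    have valid: "valid_grid (act (map Egen u) Y)" using that(1,3) by simp
    have "Y = shift a 0 (act (map Egen u) Y)"
      using shift_act[of "map Egen u" a 0 Y] that(1) by (simp add: length_tuples)
    also have "\<dots> = shift 0 b (act (map Fgen v) Y')"
      using per[of "act (map Egen u) Y"] valid that(4) by simp
    also have "\<dots> = Y'"
      using shift_act[of "map Fgen v" 0 b Y'] that(2) by (simp add: length_tuples)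
    finally show ?thesis .
  qed
  have exchange: "R u' v"
    if uv: "u \<in> tuples m a" "v \<in> tuples n b" "u' \<in> tuples m a" "v' \<in> tuples n b"
      and eq: "map Egen u @ map Fgen v \<simeq> map Fgen v' @ map Egen u'" for u v u' v'
    unfolding R_def
  proof (intro conjI allI impI)
    fix Y assume Y: "valid_grid Y"
    have "act (map Egen u) (act (map Fgen v) Y) = act (map Fgen v') (act (map Egen u') Y)"
      using act_cong[OF eq Y] by simp
    moreover have "valid_grid (act (map Fgen v) Y)" using uv Y by simp
    ultimately have "act (map Fgen v) Y = act (map Egen u') Y"
      using same_rest[OF uv(1) uv(4)] by blast
    then show "act (map Egen u') Y = act (map Fgen v) Y" ..
  qed (fact uv)+
  have "m > 0" using valid_range(1)[OF G0, of 0 0] by simp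
  have "n > 0" using valid_range(2)[OF G0, of 0 0] by simp
  with \<open>m > 0\<close> have "replicate a 1 \<in> tuples m a" "replicate b 1 \<in> tuples n b"
    by (simp_all add: tuples_def set_replicate_conv_if)
  then obtain u0 v0 where u0: "u0 \<in> tuples m a" and v0: "v0 \<in> tuples n b" by blast
  have ex_u: "\<exists>u. R u v" if v: "v \<in> tuples n b" for v
  proof -
    have "map Egen u0 @ map Fgen v \<in> gen_words m n"
      "word_degree (map Egen u0 @ map Fgen v) = (0 + a, b + 0)"
      using u0 v by (simp_all add: length_tuples)
    from exists_factorization[OF G0 this] obtain y z where yz: "y \<in> gen_words m n" "z \<in> gen_words m n"
      "word_degree y = (0, b)" "word_degree z = (a, 0)" "map Egen u0 @ map Fgen v \<simeq> y @ z" by blast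
    obtain v' where v': "y = map Fgen v'" "v' \<in> tuples n b" using word_degree_no_e yz by blast
    obtain u' where u': "z = map Egen u'" "u' \<in> tuples m a" using word_degree_no_f yz by blast
    have "R u' v" using exchange[OF u0 v u'(2) v'(2)] yz u' v' by simp
    then show ?thesis ..
  qed
  have ex_v: "\<exists>v. R u v" if u: "u \<in> tuples m a" for u
  proof -
    have "map Fgen v0 @ map Egen u \<in> gen_words m n"
      "word_degree (map Fgen v0 @ map Egen u) = (a + 0, 0 + b)"
      using v0 u by (simp_all add: length_tuples)
    from exists_factorization[OF G0 this] obtain y z where yz: "y \<in> gen_words m n" "z \<in> gen_words m n"
      "word_degree y = (a, 0)" "word_degree z = (0, b)" "map Fgen v0 @ map Egen u \<simeq> y @ z" by blast
    obtain v' where v': "z = map Fgen v'" "v' \<in> tuples n b" using word_degree_no_e yz by blast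
    obtain u' where u': "y = map Egen u'" "u' \<in> tuples m a" using word_degree_no_f yz by blast
    have "R u v'" using exchange[OF u'(2) v'(2) u v0] yz(5) u' v' word_cong_sym by simp
    then show ?thesis ..
  qed
  have R_inj: "v = v'" if "R u v" "R u v'" for u v v'
  proof (rule act_f_inject(1))
    show "length v = length v'" using that unfolding R_def by (metis length_tuples)
    show "act (map Fgen v) G\<^sub>0 = act (map Fgen v') G\<^sub>0" using that G0 unfolding R_def by metis
  qed
  have R_inj': "u = u'" if "R u v" "R u' v" for u u' v
  proof (rule act_e_inject(1))
    show "length u = length u'" using that unfolding R_def by (metis length_tuples)
    show "act (map Egen u) G\<^sub>0 = act (map Egen u') G\<^sub>0" using that G0 unfolding R_def by metis
  qed
  obtain \<gamma> where \<gamma>: "\<And>u. u \<in> tuples m a \<Longrightarrow> R u (\<gamma> u)" using ex_v by metis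
  have bij: "bij_betw \<gamma> (tuples m a) (tuples n b)"
  proof (rule bij_betw_imageI)
    show "inj_on \<gamma> (tuples m a)" using \<gamma> R_inj' by (metis inj_onI)
    show "\<gamma> ` tuples m a = tuples n b"
    proof
      show "\<gamma> ` tuples m a \<subseteq> tuples n b" using \<gamma> by (auto simp: R_def)
      show "tuples n b \<subseteq> \<gamma> ` tuples m a"
      proof
        fix v assume "v \<in> tuples n b"
        then obtain u where u: "R u v" using ex_u by blast
        then have "u \<in> tuples m a" by (simp add: R_def)
        with u \<gamma> R_inj show "v \<in> \<gamma> ` tuples m a" by blast
      qed
    qed
  qed
  have "map Egen u @ map Fgen v \<simeq> map Fgen (\<gamma> u) @ map Egen (inv_into (tuples m a) \<gamma> v)"
    if u: "u \<in> tuples m a" and v: "v \<in> tuples n b" for u v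
  proof -
    define u' where "u' = inv_into (tuples m a) \<gamma> v"
    have u': "u' \<in> tuples m a" "\<gamma> u' = v"
      using bij v inv_into_into[of v \<gamma> "tuples m a"] f_inv_into_f[of v \<gamma> "tuples m a"]
      by (simp_all add: u'_def bij_betw_def)
    have gu: "\<gamma> u \<in> tuples n b" using \<gamma>[OF u] by (simp add: R_def)
    have "act (map Egen u) (act (map Fgen v) G\<^sub>0) = act (map Fgen (\<gamma> u)) (act (map Fgen v) G\<^sub>0)"
      using \<gamma>[OF u] G0 v by (simp add: R_def)
    also have "act (map Fgen v) G\<^sub>0 = act (map Egen u') G\<^sub>0"
      using \<gamma>[OF u'(1)] G0 u'(2) by (simp add: R_def)
    finally show ?thesis
      unfolding u'_def[symmetric] using u v u' gu
      by (intro act_faithful[OF _ _ _ G0]) (simp_all add: length_tuples \<open>act (map Fgen v) G\<^sub>0 = _\<close>)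
  qed
  with bij show ?thesis unfolding intertwines_def by blast
qed

lemma decompose_e_f:
  assumes "valid_grid G"
  obtains u v Y where "u \<in> tuples m a" "v \<in> tuples n b" "valid_grid Y"
    "G = act (map Egen u) (act (map Fgen v) Y)" "Y = shift a b G"
proof -
  obtain x where x: "x \<in> gen_words m n" "word_degree x = (a, 0)" "act x (shift a 0 G) = G"
    using exists_prefix[OF assms] by blast
  obtain y where y: "y \<in> gen_words m n" "word_degree y = (0, b)"
      "act y (shift 0 b (shift a 0 G)) = shift a 0 G"
    using exists_prefix[OF valid_shift[OF assms]] by blast
  obtain u where u: "x = map Egen u" "u \<in> tuples m a" using word_degree_no_f x by blast
  obtain v where v: "y = map Fgen v" "v \<in> tuples n b" using word_degree_no_e y by blast
  have "shift 0 b (shift a 0 G) = shift a b G" by simp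
  then have "G = act (map Egen u) (act (map Fgen v) (shift a b G))"
    using x(3) y(3) u(1) v(1) by (simp only:)
  from that[OF u(2) v(2) valid_shift[OF assms] this refl] show ?thesis .
qed

text \<open>
  Write \<open>Y = e\<^sub>u\<^sub>1 f\<^sub>v\<^sub>1 Z\<close> and let \<open>u\<^sub>2\<close> be the word with \<open>\<gamma> u\<^sub>2 = v\<^sub>1\<close>. Two uses of the commutation
  rule give \<open>e\<^sub>u Y = e\<^sub>u f\<^sub>\<gamma>\<^sub>u\<^sub>1 e\<^sub>u\<^sub>2 Z = f\<^sub>\<gamma>\<^sub>u e\<^sub>u\<^sub>1 e\<^sub>u\<^sub>2 Z\<close>, whereas
  \<open>f\<^sub>\<gamma>\<^sub>u Y = f\<^sub>\<gamma>\<^sub>u e\<^sub>u\<^sub>1 f\<^sub>\<gamma>\<^sub>u\<^sub>2 Z\<close>. The common prefix \<open>f\<^sub>\<gamma>\<^sub>u e\<^sub>u\<^sub>1\<close> has degree \<open>(a, b)\<close>, and what remains is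
  the same question for \<open>u\<^sub>2\<close> and \<open>Z\<close>.
\<close>

lemma intertwines_common_prefix:
  assumes \<gamma>: "intertwines a b \<gamma>" and u: "u \<in> tuples m a" and Y: "valid_grid Y"
  shows "\<exists>x \<in> gen_words m n. \<exists>Z Z'. word_degree x = (N * a, N * b) \<and> valid_grid Z \<and> valid_grid Z' \<and>
      act (map Egen u) Y = act x Z \<and> act (map Fgen (\<gamma> u)) Y = act x Z'"
  using u Y
proof (induction N arbitrary: u Y)
  case 0
  have "\<gamma> u \<in> tuples n b" using \<gamma> 0 by (auto simp: intertwines_def bij_betw_def)
  then show ?case
    using 0 by (intro bexI[of _ "[]"] exI[of _ "act (map Egen u) Y"]
        exI[of _ "act (map Fgen (\<gamma> u)) Y"]) auto
next
  case (Suc N)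
  let ?inv = "inv_into (tuples m a) \<gamma>"
  have commute: "act (map Egen u) (act (map Fgen v) Z) = act (map Fgen (\<gamma> u)) (act (map Egen (?inv v)) Z)"
    if "u \<in> tuples m a" "v \<in> tuples n b" "valid_grid Z" for u v Z
    using act_cong[OF _ that(3)] \<gamma> that(1,2) unfolding intertwines_def by fastforce
  have range: "\<gamma> u \<in> tuples n b" if "u \<in> tuples m a" for u
    using \<gamma> that by (auto simp: intertwines_def bij_betw_def)
  have inv: "?inv v \<in> tuples m a" "\<gamma> (?inv v) = v" if "v \<in> tuples n b" for v
    using \<gamma> that inv_into_into[of v \<gamma> "tuples m a"] f_inv_into_f[of v \<gamma> "tuples m a"]
    by (simp_all add: intertwines_def bij_betw_def)
  have left_inv: "?inv (\<gamma> u) = u" if "u \<in> tuples m a" for u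
    using \<gamma> that by (simp add: intertwines_def bij_betw_def)
  obtain u1 v1 Z where uv1: "u1 \<in> tuples m a" "v1 \<in> tuples n b" and Z: "valid_grid Z"
    and Y: "Y = act (map Egen u1) (act (map Fgen v1) Z)"
    using decompose_e_f[OF Suc.prems(2)] by blast
  have "act (map Egen u) Y = act (map Egen u) (act (map Fgen (\<gamma> u1)) (act (map Egen (?inv v1)) Z))"
    using commute[OF uv1 Z] Y by simp
  also have "\<dots> = act (map Fgen (\<gamma> u)) (act (map Egen u1) (act (map Egen (?inv v1)) Z))"
    using commute[OF Suc.prems(1) range[OF uv1(1)]] left_inv[OF uv1(1)] inv[OF uv1(2)] Z by simp
  finally have 1: "act (map Egen u) Y =
      act (map Fgen (\<gamma> u) @ map Egen u1) (act (map Egen (?inv v1)) Z)" by simp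
  have 2: "act (map Fgen (\<gamma> u)) Y =
      act (map Fgen (\<gamma> u) @ map Egen u1) (act (map Fgen (\<gamma> (?inv v1))) Z)"
    using Y inv(2)[OF uv1(2)] by simp
  obtain x X X' where x: "x \<in> gen_words m n" "word_degree x = (N * a, N * b)"
      "valid_grid X" "valid_grid X'"
      "act (map Egen (?inv v1)) Z = act x X" "act (map Fgen (\<gamma> (?inv v1))) Z = act x X'"
    using Suc.IH[OF inv(1)[OF uv1(2)] Z] by blast
  let ?x = "map Fgen (\<gamma> u) @ map Egen u1 @ x"
  have words: "?x \<in> gen_words m n" and "word_degree ?x = (Suc N * a, Suc N * b)"
    using x(1,2) range[OF Suc.prems(1)] uv1 by (simp_all add: length_tuples)
  moreover have "act (map Egen u) Y = act ?x X" "act (map Fgen (\<gamma> u)) Y = act ?x X'"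
    by (simp_all only: 1 2 x(5,6) act_append)
  ultimately have "word_degree ?x = (Suc N * a, Suc N * b) \<and> valid_grid X \<and> valid_grid X' \<and>
      act (map Egen u) Y = act ?x X \<and> act (map Fgen (\<gamma> u)) Y = act ?x X'"
    using x(3,4) by (intro conjI)
  then show ?case by (intro bexI[OF _ words] exI)
qed

text \<open>
  Arbitrarily long common prefixes make \<open>e\<^sub>u Y\<close> and \<open>f\<^sub>\<gamma>\<^sub>u Y\<close> equal, provided that \<open>a\<close> and \<open>b\<close> are
  positive so that the prefixes grow in both directions. Applied to \<open>G = e\<^sub>u f\<^sub>v Y = f\<^sub>\<gamma>\<^sub>u e\<^sub>u\<^sub>' Y\<close>
  with \<open>\<gamma> u' = v\<close>, the remainders \<open>f\<^sub>v Y\<close> and \<open>e\<^sub>u\<^sub>' Y\<close> coincide.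
\<close>

lemma intertwines_imp_periodic:
  assumes \<gamma>: "intertwines a b \<gamma>" and ab: "0 < a" "0 < b" and G: "valid_grid G"
  shows "shift a 0 G = shift 0 b G"
proof -
  have same: "act (map Egen u) Y = act (map Fgen (\<gamma> u)) Y"
    if u: "u \<in> tuples m a" and Y: "valid_grid Y" for u Y
  proof (intro ext)
    fix k l
    define N where "N = Suc (k + l)"
    obtain x X X' where x: "x \<in> gen_words m n" "word_degree x = (N * a, N * b)"
        "valid_grid X" "valid_grid X'"
        "act (map Egen u) Y = act x X" "act (map Fgen (\<gamma> u)) Y = act x X'"
      using intertwines_common_prefix[OF \<gamma> u Y] by blast
    have "N \<le> N * a" "N \<le> N * b" using ab by simp_all
    then have "k < N * a" "l < N * b" by (simp_all add: N_def)
    then show "act (map Egen u) Y k l = act (map Fgen (\<gamma> u)) Y k l"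
      using prefix_determines[OF x(1,2) _ _ x(3,4)] x(5,6) by simp
  qed
  obtain u v Y where uv: "u \<in> tuples m a" "v \<in> tuples n b" and Y: "valid_grid Y"
    and G_eq: "G = act (map Egen u) (act (map Fgen v) Y)"
    using decompose_e_f[OF G] by blast
  define u' where "u' = inv_into (tuples m a) \<gamma> v"
  have u': "u' \<in> tuples m a" "\<gamma> u' = v"
    using \<gamma> uv(2) inv_into_into[of v \<gamma> "tuples m a"] f_inv_into_f[of v \<gamma> "tuples m a"]
    by (simp_all add: u'_def intertwines_def bij_betw_def)
  have gu: "\<gamma> u \<in> tuples n b" using \<gamma> uv by (auto simp: intertwines_def bij_betw_def)
  have "map Egen u @ map Fgen v \<simeq> map Fgen (\<gamma> u) @ map Egen u'"
    using \<gamma> uv unfolding intertwines_def u'_def by blast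
  from act_cong[OF this Y] have "G = act (map Fgen (\<gamma> u)) (act (map Egen u') Y)"
    using G_eq by simp
  then have "shift 0 b G = act (map Egen u') Y"
    using shift_act[of "map Fgen (\<gamma> u)" 0 b] gu by (simp add: length_tuples)
  also have "\<dots> = act (map Fgen v) Y" using same[OF u'(1) Y] u'(2) by simp
  also have "\<dots> = shift a 0 G"
    using shift_act[of "map Egen u" a 0] uv G_eq by (simp add: length_tuples)
  finally show ?thesis by simp
qed

lemma intertwines_iff:
  "intertwines a b \<gamma> \<longleftrightarrow> bij_betw \<gamma> (tuples m a) (tuples n b) \<and>
     (\<forall>u \<in> tuples m a. \<forall>v \<in> tuples n b.
        e_word m n \<theta> u \<otimes>\<^bsub>Fplus m n \<theta>\<^esub> f_word m n \<theta> v =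
        f_word m n \<theta> (\<gamma> u) \<otimes>\<^bsub>Fplus m n \<theta>\<^esub> e_word m n \<theta> (inv_into (tuples m a) \<gamma> v))"
proof -
  have "map Egen u @ map Fgen v \<simeq> map Fgen (\<gamma> u) @ map Egen (inv_into (tuples m a) \<gamma> v) \<longleftrightarrow>
      e_word m n \<theta> u \<otimes>\<^bsub>Fplus m n \<theta>\<^esub> f_word m n \<theta> v =
      f_word m n \<theta> (\<gamma> u) \<otimes>\<^bsub>Fplus m n \<theta>\<^esub> e_word m n \<theta> (inv_into (tuples m a) \<gamma> v)"
    if bij: "bij_betw \<gamma> (tuples m a) (tuples n b)" and u: "u \<in> tuples m a" and v: "v \<in> tuples n b"
    for u v
  proof -
    have "\<gamma> u \<in> tuples n b" using bij u by (auto simp: bij_betw_def)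
    moreover have "inv_into (tuples m a) \<gamma> v \<in> tuples m a"
      using bij v inv_into_into[of v \<gamma> "tuples m a"] by (simp add: bij_betw_def)
    ultimately show ?thesis
      using u v by (simp add: tuples_def e_word_eq_class f_word_eq_class mult_word_class word_class_eq_iff map_gen_words)
  qed
  then show ?thesis unfolding intertwines_def by auto
qed

section \<open>A single generator \<open>e\<close>\<close>

lemma row_perm_grid:
  assumes "m = 1" and G: "valid_grid G"
  shows "G k l = (1, (row_perm \<theta> ^^ b) (snd (G (k + b) l)))"
proof (induction b)
  case 0
  then show ?case using valid_range(1)[OF G, of k l] \<open>m = 1\<close> by (simp add: prod_eq_iff)
next
  case (Suc b)
  have "snd (G (k + b) l) = row_perm \<theta> (snd (G (k + Suc b) l))"
    using valid_square[OF G, of "k + b" l] valid_range(1)[OF G, of "k + b" l] \<open>m = 1\<close>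
    by (simp add: row_perm_def)
  with Suc show ?case by (simp add: funpow_swap1)
qed

end

lemma sym_group_pow: "p [^]\<^bsub>sym_group n\<^esub> (k::nat) = p ^^ k"
  by (induction k) (simp_all add: sym_group_one sym_group_mult nat_pow_def funpow_swap1 fun_eq_iff)

theorem theorem3p1:
  fixes m n :: nat and \<theta> :: "nat \<times> nat \<Rightarrow> nat \<times> nat"
  assumes "\<theta> permutes {1..m} \<times> {1..n}"
  shows
    "(2 \<le> m \<and> m \<le> n \<longrightarrow>
        (\<forall>a b :: nat. 0 < a \<and> 0 < b \<longrightarrow>
          ((\<forall>\<tau>. is_tail m n \<tau> \<longrightarrow> eventually_periodic_tail m n \<theta> (int a, - int b) \<tau>) \<longleftrightarrow>
           (\<forall>\<tau>. is_tail m n \<tau> \<longrightarrow> periodic_tail m n \<theta> (int a, - int b) \<tau>)) \<and>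
          ((\<forall>\<tau>. is_tail m n \<tau> \<longrightarrow> periodic_tail m n \<theta> (int a, - int b) \<tau>) \<longleftrightarrow>
           (m ^ a = n ^ b \<and>
            (\<exists>\<gamma>. bij_betw \<gamma> (tuples m a) (tuples n b) \<and>
              (\<forall>u \<in> tuples m a. \<forall>v \<in> tuples n b.
                 e_word m n \<theta> u \<otimes>\<^bsub>Fplus m n \<theta>\<^esub> f_word m n \<theta> v =
                 f_word m n \<theta> (\<gamma> u) \<otimes>\<^bsub>Fplus m n \<theta>\<^esub> e_word m n \<theta> (inv_into (tuples m a) \<gamma> v)))))))
     \<and>
     (m = 1 \<and> 1 < n \<longrightarrow>
        periodic_semigroup m n \<theta> (int (group.ord (sym_group n) (row_perm \<theta>)), 0))"
proof -
  interpret one_vertex_2graph m n \<theta> by unfold_locales (fact assms)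
  show ?thesis
  proof (intro conjI impI allI)
    fix a b :: nat
    assume "2 \<le> m \<and> m \<le> n" and "0 < a \<and> 0 < b"
    then have ab: "0 < a" "0 < b" and mn: "0 < m" "0 < n" by auto
    have ev: "eventually_periodic_tail m n \<theta> (int a, - int b) (tail_of G)"
      if G: "valid_grid G" and per: "shift a 0 G = shift 0 b G" for G
    proof -
      have "G (k + a) l = G k (l + b)" for k l
        using fun_cong[OF fun_cong[OF per], of k l] by simp
      then show ?thesis using eventually_periodic_tail_of[OF G] by blast
    qed
    show "(\<forall>\<tau>. is_tail m n \<tau> \<longrightarrow> eventually_periodic_tail m n \<theta> (int a, - int b) \<tau>) \<longleftrightarrow>
        (\<forall>\<tau>. is_tail m n \<tau> \<longrightarrow> periodic_tail m n \<theta> (int a, - int b) \<tau>)"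
      unfolding all_tails_iff
      using ev eventually_periodic_imp_periodic[of a b] eventually_periodic_tail_of periodic_tail_of
      by metis
    \<comment> \<open>Some grid must exist for the bijection to be well defined; a constant tail supplies one.\<close>
    have "is_tail m n (\<lambda>_. (1, 1))" using mn by (simp add: is_tail_def)
    then have G0: "valid_grid (grid_of (\<lambda>_. (1, 1)))" by (rule valid_grid_of)
    have card: "card (tuples k c) = k ^ c" for k c
      using card_lists_length_eq[of "{1..k}" c] by (simp add: tuples_def)
    have "m ^ a = n ^ b" if "intertwines a b \<gamma>" for \<gamma>
      using that bij_betw_same_card[of \<gamma> "tuples m a" "tuples n b"]
      by (simp add: intertwines_def card)
    moreover have "(\<forall>\<tau>. is_tail m n \<tau> \<longrightarrow> periodic_tail m n \<theta> (int a, - int b) \<tau>) \<longleftrightarrow>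
        (\<exists>\<gamma>. intertwines a b \<gamma>)"
      unfolding all_tails_iff
      using periodic_imp_intertwines[OF G0, of a b] intertwines_imp_periodic[OF _ ab]
        periodic_tail_of by metis
    ultimately show "(\<forall>\<tau>. is_tail m n \<tau> \<longrightarrow> periodic_tail m n \<theta> (int a, - int b) \<tau>) \<longleftrightarrow>
        (m ^ a = n ^ b \<and>
         (\<exists>\<gamma>. bij_betw \<gamma> (tuples m a) (tuples n b) \<and>
           (\<forall>u \<in> tuples m a. \<forall>v \<in> tuples n b.
              e_word m n \<theta> u \<otimes>\<^bsub>Fplus m n \<theta>\<^esub> f_word m n \<theta> v =
              f_word m n \<theta> (\<gamma> u) \<otimes>\<^bsub>Fplus m n \<theta>\<^esub> e_word m n \<theta> (inv_into (tuples m a) \<gamma> v))))"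
      unfolding intertwines_iff[symmetric] by blast
  next
    assume m: "m = 1 \<and> 1 < n"
    define b where "b = group.ord (sym_group n) (row_perm \<theta>)"
    have "row_perm \<theta> \<in> carrier (sym_group n)"
      using row_perm_permutes assms m by (simp add: sym_group_carrier)
    then have "row_perm \<theta> [^]\<^bsub>sym_group n\<^esub> b = \<one>\<^bsub>sym_group n\<^esub>"
      unfolding b_def by (rule group.pow_ord_eq_1[OF sym_group_is_group])
    then have id: "row_perm \<theta> ^^ b = id" by (simp add: sym_group_pow sym_group_one)
    have "shift b 0 G = shift 0 0 G" if G: "valid_grid G" for G
    proof (intro ext)
      fix k l
      have "G k l = (1, snd (G (k + b) l))" using row_perm_grid[OF _ G, of k l b] m id by simp
      moreover have "fst (G (k + b) l) = 1" using valid_range(1)[OF G, of "k + b" l] m by simp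
      ultimately have "G (k + b) l = G k l" by (metis prod.collapse)
      then show "shift b 0 G k l = shift 0 0 G k l" by simp
    qed
    then have "periodic_tail m n \<theta> (int b, - int 0) (tail_of G)" if "valid_grid G" for G
      using periodic_tail_of that by blast
    then show "periodic_semigroup m n \<theta> (int (group.ord (sym_group n) (row_perm \<theta>)), 0)"
      unfolding periodic_semigroup_def all_tails_iff b_def[symmetric] by simp
  qed
qed

end
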